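(* Let $y_1,y_2,\dots$ be further commuting variables and $\bar\tau_1,\bar\tau_2,\dots,\underline\tau_1,\underline\tau_2,\dots$ further Grassmann variables (all odd variables $\phi_i,\theta_i,\bar\tau_j,\underline\tau_j$ pairwise anticommute; they commute with all $x_i,y_j$). Then, as formal power series, $$K:=\prod_{i,j}\frac{1}{1-x_iy_j-\phi_i\bar\tau_j-\theta_i\underline\tau_j}=\sum_{\Lambda}(-1)^{\binom{\bar m+\underline m}{2}}\,z_\Lambda^{-1}\zeta_\Lambda^{-1}\,p_\Lambda(x,\phi,\theta)\,p_\Lambda(y,\bar\tau,\underline\tau),$$ where the sum runs over all $\mathcal N=2$ superpartitions $\Lambda$ and $(\bar m,\underline m)$ are the fermionic degrees of $\Lambda$.
   Context: Power sums: $p_n=\sum_ix_i^n$ ($n\ge1$), $p_0:=0$; for $n\ge0$, $\bar p_n=\sum_i\phi_ix_i^n$, $\underline p_n=\sum_i\theta_ix_i^n$, $\bar{\underline p}_n=\sum_i\phi_i\theta_ix_i^n$; $p_\Lambda(y,\bar\tau,\underline\tau)$ denotes the same expression with $x_i,\phi_i,\theta_i$ replaced by $y_i,\bar\tau_i,\underline\tau_i$. An $\mathcal N=2$ superpartition $\Lambda$ is a finite multiset of parts, each a nonnegative integer $a$ with one of the markings bilined ($\bar{\underline a}$), overlined ($\bar a$), underlined ($\underline a$), unmarked ($a$); overlined parts are pairwise distinct, underlined parts pairwise distinct, unmarked zero parts are disregarded (marked zeros kept). Parts are listed $\Lambda=(\Lambda_1,\dots,\Lambda_\ell)$ in nonincreasing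 order of value, ties ordered bilined, overlined, underlined, unmarked. $\bar m=\#$overlined$+\#$bilined parts, $\underline m=\#$underlined$+\#$bilined parts. $p_\Lambda=\tilde p_{\Lambda_1}\cdots\tilde p_{\Lambda_\ell}$ (product in this order), $\tilde p_{\Lambda_i}$ being $\bar{\underline p}_n,\bar p_n,\underline p_n,p_n$ ($n=|\Lambda_i|$) according to the marking of $\Lambda_i$. $z_\Lambda=\prod_{k\ge1}k^{n_k}n_k!$ where $n_k$ is the number of unmarked parts equal to $k$; $\zeta_\Lambda=\prod_{k\ge0}\frac{n'_k!}{(k+1)^{n'_k}}$ where $n'_k$ is the number of bilined parts equal to $k$. *)

theory Defs
  imports Complex_Main "HOL-Library.Multiset"
begin

datatype evar = X nat | Y nat
datatype ovar = Phi nat | Theta nat | TauB nat | TauU nat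

text \<open>A fixed total order on the odd variables (via an injective code into nat),
  used to choose the basis of ordered odd monomials.\<close>
fun ocode :: "ovar \<Rightarrow> nat" where
  "ocode (Phi i) = 4 * i"
| "ocode (Theta i) = 4 * i + 1"
| "ocode (TauB i) = 4 * i + 2"
| "ocode (TauU i) = 4 * i + 3"

text \<open>A monomial: a multiset of even variables (exponents) times the product of a
  finite set of odd variables, taken in increasing ocode order.
  A formal power series is its coefficient function.\<close>
type_synonym mono = "evar multiset \<times> ovar set"
type_synonym series = "mono \<Rightarrow> real"

text \<open>Sign arising when multiplying the ordered odd monomials S1 and S2 (disjoint)
  and reordering into increasing order.\<close>
definition osign :: "ovar set \<Rightarrow> ovar set \<Rightarrow> real" where
  "osign S1 S2 = (-1) ^ card {(a, b). a \<in> S1 \<and> b \<in> S2 \<and> ocode b < ocode a}"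

definition szero :: series where "szero = (\<lambda>_. 0)"

definition sone :: series where
  "sone = (\<lambda>(M, S). if M = {#} \<and> S = {} then 1 else 0)"

definition sadd :: "series \<Rightarrow> series \<Rightarrow> series" where
  "sadd f g = (\<lambda>\<mu>. f \<mu> + g \<mu>)"

definition sscale :: "real \<Rightarrow> series \<Rightarrow> series" where
  "sscale c f = (\<lambda>\<mu>. c * f \<mu>)"

text \<open>Product in the (super)commutative algebra: Grassmann variables anticommute
  and square to zero, even variables commute with everything.\<close>
definition smul :: "series \<Rightarrow> series \<Rightarrow> series" where
  "smul f g = (\<lambda>(M, S). \<Sum>M1\<in>{N. N \<subseteq># M}. \<Sum>S1\<in>Pow S.
       f (M1, S1) * g (M - M1, S - S1) * osign S1 (S - S1))"

fun spow :: "series \<Rightarrow> nat \<Rightarrow> series" where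
  "spow f 0 = sone"
| "spow f (Suc n) = smul f (spow f n)"

text \<open>Formal (coefficientwise) sum of a family of series; meaningful when for each
  monomial only finitely many members have a nonzero coefficient, which is the
  case for every use below.\<close>
definition ssum :: "('i \<Rightarrow> series) \<Rightarrow> series" where
  "ssum F = (\<lambda>\<mu>. \<Sum>i | F i \<mu> \<noteq> 0. F i \<mu>)"

definition seven :: "evar \<Rightarrow> series" where
  "seven v = (\<lambda>(M, S). if M = {#v#} \<and> S = {} then 1 else 0)"

definition sodd :: "ovar \<Rightarrow> series" where
  "sodd w = (\<lambda>(M, S). if M = {#} \<and> S = {w} then 1 else 0)"

datatype mark = MBi | MOv | MUn | MPlain

text \<open>A superpartition is a finite multiset of marked parts (marking, value).
  Overlined parts pairwise distinct, underlined parts pairwise distinct,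
  no unmarked zero parts (they are disregarded).\<close>
type_synonym spart = "(mark \<times> nat) multiset"

definition is_sp :: "spart \<Rightarrow> bool" where
  "is_sp \<Lambda> \<longleftrightarrow> (\<forall>a. count \<Lambda> (MOv, a) \<le> 1) \<and> (\<forall>a. count \<Lambda> (MUn, a) \<le> 1)
                 \<and> count \<Lambda> (MPlain, 0) = 0"

fun mrank :: "mark \<Rightarrow> nat" where
  "mrank MBi = 0" | "mrank MOv = 1" | "mrank MUn = 2" | "mrank MPlain = 3"

text \<open>Sorting key: larger key comes first; nonincreasing value, ties ordered
  bilined, overlined, underlined, unmarked.\<close>
definition part_key :: "mark \<times> nat \<Rightarrow> nat" where
  "part_key p = 4 * snd p + (3 - mrank (fst p))"

definition parts :: "spart \<Rightarrow> (mark \<times> nat) list" where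
  "parts \<Lambda> = (SOME xs. mset xs = \<Lambda> \<and> sorted_wrt (\<lambda>p q. part_key q \<le> part_key p) xs)"

definition mbar :: "spart \<Rightarrow> nat" where
  "mbar \<Lambda> = size (filter_mset (\<lambda>p. fst p = MOv \<or> fst p = MBi) \<Lambda>)"

definition munder :: "spart \<Rightarrow> nat" where
  "munder \<Lambda> = size (filter_mset (\<lambda>p. fst p = MUn \<or> fst p = MBi) \<Lambda>)"

definition zee :: "spart \<Rightarrow> real" where
  "zee \<Lambda> = (\<Prod>k\<in>{k. k \<ge> 1 \<and> (MPlain, k) \<in># \<Lambda>}.
               real k ^ count \<Lambda> (MPlain, k) * fact (count \<Lambda> (MPlain, k)))"

definition zeta :: "spart \<Rightarrow> real" where
  "zeta \<Lambda> = (\<Prod>k\<in>{k. (MBi, k) \<in># \<Lambda>}.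
               fact (count \<Lambda> (MBi, k)) / real (k + 1) ^ count \<Lambda> (MBi, k))"

definition ptilde :: "(nat \<Rightarrow> evar) \<Rightarrow> (nat \<Rightarrow> ovar) \<Rightarrow> (nat \<Rightarrow> ovar) \<Rightarrow> mark \<times> nat \<Rightarrow> series" where
  "ptilde E F G p = (case p of (m, n) \<Rightarrow> (case m of
      MBi \<Rightarrow> ssum (\<lambda>i. smul (smul (sodd (F i)) (sodd (G i))) (spow (seven (E i)) n))
    | MOv \<Rightarrow> ssum (\<lambda>i. smul (sodd (F i)) (spow (seven (E i)) n))
    | MUn \<Rightarrow> ssum (\<lambda>i. smul (sodd (G i)) (spow (seven (E i)) n))
    | MPlain \<Rightarrow> (if n = 0 then szero else ssum (\<lambda>i. spow (seven (E i)) n))))"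

definition pLam :: "(nat \<Rightarrow> evar) \<Rightarrow> (nat \<Rightarrow> ovar) \<Rightarrow> (nat \<Rightarrow> ovar) \<Rightarrow> spart \<Rightarrow> series" where
  "pLam E F G \<Lambda> = foldr smul (map (ptilde E F G) (parts \<Lambda>)) sone"

definition cauchy_term :: "spart \<Rightarrow> series" where
  "cauchy_term \<Lambda> = sscale ((-1) ^ ((mbar \<Lambda> + munder \<Lambda>) choose 2) / (zee \<Lambda> * zeta \<Lambda>))
       (smul (pLam X Phi Theta \<Lambda>) (pLam Y TauB TauU \<Lambda>))"

definition uvar :: "nat \<Rightarrow> nat \<Rightarrow> series" where
  "uvar i j = sadd (sadd (smul (seven (X i)) (seven (Y j)))
                         (smul (sodd (Phi i)) (sodd (TauB j))))
                   (smul (sodd (Theta i)) (sodd (TauU j)))"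

text \<open>1/(1-u) = sum of u^k (u has no constant term, so this is a formal sum).\<close>
definition geom :: "series \<Rightarrow> series" where
  "geom u = ssum (\<lambda>k. spow u k)"

text \<open>Finite partial products of the kernel over 0 <= i, j < N; the infinite product
  K is their coefficientwise (formal) limit as N grows.\<close>
definition Kfin :: "nat \<Rightarrow> series" where
  "Kfin N = foldr smul (map (\<lambda>(i, j). geom (uvar i j)) (List.product [0..<N] [0..<N])) sone"

end

theory Submission
  imports Defs "HOL-Computational_Algebra.Formal_Power_Series"
begin

text \<open>With \<open>u i j\<close> denoting the even element \<open>x\<^sub>i y\<^sub>j + \<phi>\<^sub>i \<tau>\<^sub>j + \<theta>\<^sub>i \<tau>'\<^sub>j\<close>, the degree \<open>2d\<close> part of a finite
  kernel is the complete homogeneous function \<open>h\<^sub>d\<close> of the commuting elements \<open>u i j\<close>, hence is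
  determined by Newton's recurrence from the sums of the \<open>u i j ^ k\<close>. Since the squares of \<open>\<phi>\<^sub>i \<tau>\<^sub>j\<close> and
  \<open>\<theta>\<^sub>i \<tau>'\<^sub>j\<close> vanish, \<open>u i j ^ k\<close> has only four terms, and the sum over \<open>i\<close> and \<open>j\<close> is \<open>k\<close> times the
  sum of \<open>c p * A p * B p\<close> over the parts \<open>p\<close> of weight \<open>k\<close>, where \<open>A p\<close> and \<open>B p\<close> are the two power sums
  of \<open>p\<close>. The sum over all multisets of parts of the products of the \<open>(c p * A p * B p) ^ n / n!\<close> satisfies
  the same recurrence. Multisets that repeat an overlined or underlined part contribute 0, and
  bringing each \<open>B p\<close> next to \<open>A p\<close> produces the sign of the theorem. Coefficients of a fixed monomial only
  involve finitely many variables, so that setting all other variables to 0 is harmless.\<close>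

section \<open>The algebra of series\<close>

lemma finite_sub_mset: "finite {N. N \<subseteq># M}"
proof (induction M)
  case (add x M)
  have "{N. N \<subseteq># add_mset x M} \<subseteq> {N. N \<subseteq># M} \<union> add_mset x ` {N. N \<subseteq># M}"
  proof
    fix N assume N: "N \<in> {N. N \<subseteq># add_mset x M}"
    show "N \<in> {N. N \<subseteq># M} \<union> add_mset x ` {N. N \<subseteq># M}"
    proof (cases "x \<in># N")
      case True
      then obtain N' where "N = add_mset x N'" by (metis insert_DiffM)
      then show ?thesis using N by auto
    next
      case False
      then have "N \<subseteq># M" using N
        by (metis diff_single_trivial mem_Collect_eq add_mset_remove_trivial subset_eq_diff_conv
            add_mset_add_single)
      then show ?thesis by simp
    qed
  qed
  then show ?case using add finite_subset by blast
qed simp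

section \<open>Signs from reordering odd monomials\<close>

lemma finite_inversions:
  assumes "finite A" "finite B"
  shows "finite {(a, b). a \<in> A \<and> b \<in> B \<and> ocode b < ocode a}"
  by (rule finite_subset[of _ "A \<times> B"]) (use assms in auto)

text \<open>Inversions are pairs, so those starting in a disjoint union are counted separately on
  each piece. Multiplicativity of the sign in both arguments is what associativity of the product
  rests on.\<close>

lemma osign_union_left:
  assumes "finite A" "finite B" "finite C" "A \<inter> B = {}"
  shows "osign (A \<union> B) C = osign A C * osign B C"
proof -
  let ?I = "\<lambda>A. {(a, c). a \<in> A \<and> c \<in> C \<and> ocode c < ocode a}"
  have "?I (A \<union> B) = ?I A \<union> ?I B" "?I A \<inter> ?I B = {}" using assms by auto
  then have "card (?I (A \<union> B)) = card (?I A) + card (?I B)"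
    using assms finite_inversions by (metis (no_types, lifting) card_Un_disjoint)
  then show ?thesis unfolding osign_def by (simp add: power_add)
qed

lemma osign_union_right:
  assumes "finite A" "finite B" "finite C" "B \<inter> C = {}"
  shows "osign A (B \<union> C) = osign A B * osign A C"
proof -
  let ?I = "\<lambda>B. {(a, c). a \<in> A \<and> c \<in> B \<and> ocode c < ocode a}"
  have "?I (B \<union> C) = ?I B \<union> ?I C" "?I B \<inter> ?I C = {}" using assms by auto
  then have "card (?I (B \<union> C)) = card (?I B) + card (?I C)"
    using assms finite_inversions by (metis (no_types, lifting) card_Un_disjoint)
  then show ?thesis unfolding osign_def by (simp add: power_add)
qed

lemma osign_empty [simp]: "osign {} S = 1" "osign S {} = 1"
  by (simp_all add: osign_def)

lemma ocode_inject: "ocode a = ocode b \<longleftrightarrow> a = b"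
  by (cases a; cases b; simp; presburger)

text \<open>As \<open>ocode\<close> is injective, each pair in \<open>A \<times> B\<close> is an
  inversion in exactly one of the two orders, so the two inversion numbers add up to
  \<open>card A * card B\<close>.\<close>

lemma osign_swap:
  assumes "finite A" "finite B" "A \<inter> B = {}"
  shows "osign B A = (-1) ^ (card A * card B) * osign A B"
proof -
  let ?I = "{(a, b). a \<in> A \<and> b \<in> B \<and> ocode b < ocode a}"
  let ?J = "{(b, a). b \<in> B \<and> a \<in> A \<and> ocode a < ocode b}"
  have "A \<times> B = ?I \<union> prod.swap ` ?J"
    using assms(3) ocode_inject by (auto simp: image_iff disjoint_iff) (metis nat_neq_iff)
  moreover have "?I \<inter> prod.swap ` ?J = {}" by auto
  ultimately have "card (A \<times> B) = card ?I + card (prod.swap ` ?J)"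
    using finite_inversions[OF assms(1,2)] finite_inversions[OF assms(2,1)]
    by (simp only: card_Un_disjoint finite_imageI)
  also have "card (prod.swap ` ?J) = card ?J"
    by (rule card_image) simp
  finally have "(-1::real) ^ (card A * card B) * osign A B = (-1) ^ (card ?I + card ?I) * osign B A"
    by (simp add: osign_def power_add card_cartesian_product)
  then show ?thesis by simp
qed

text \<open>Recording both factors, instead of a factor and its complement, makes associativity and
  supercommutation plain reindexings of sums.\<close>

definition mono_splits :: "mono \<Rightarrow> (mono \<times> mono) set" where
  "mono_splits \<mu> = {(\<alpha>, \<beta>). fst \<alpha> + fst \<beta> = fst \<mu> \<and> snd \<alpha> \<union> snd \<beta> = snd \<mu> \<and> snd \<alpha> \<inter> snd \<beta> = {}}"

lemma bij_betw_mono_splits: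
  "bij_betw (\<lambda>(N, T). ((N, T), (M - N, S - T))) ({N. N \<subseteq># M} \<times> Pow S) (mono_splits (M, S))"
  by (rule bij_betwI[where g = fst]) (auto simp: mono_splits_def)

lemma finite_mono_splits:
  assumes "finite (snd \<mu>)"
  shows "finite (mono_splits \<mu>)"
  using bij_betw_finite[OF bij_betw_mono_splits[of "fst \<mu>" "snd \<mu>"]] assms finite_sub_mset
  by auto

lemma smul_splits:
  assumes "finite (snd \<mu>)"
  shows "smul f g \<mu> = (\<Sum>(\<alpha>, \<beta>)\<in>mono_splits \<mu>. f \<alpha> * g \<beta> * osign (snd \<alpha>) (snd \<beta>))"
proof -
  have "smul f g \<mu> = (\<Sum>(N, T)\<in>{N. N \<subseteq># fst \<mu>} \<times> Pow (snd \<mu>).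
       f (N, T) * g (fst \<mu> - N, snd \<mu> - T) * osign T (snd \<mu> - T))"
    by (simp add: smul_def case_prod_beta sum.cartesian_product)
  also have "\<dots> = (\<Sum>(\<alpha>, \<beta>)\<in>mono_splits \<mu>. f \<alpha> * g \<beta> * osign (snd \<alpha>) (snd \<beta>))"
    using sum.reindex_bij_betw[OF bij_betw_mono_splits[of "fst \<mu>" "snd \<mu>"],
        of "\<lambda>(\<alpha>, \<beta>). f \<alpha> * g \<beta> * osign (snd \<alpha>) (snd \<beta>)"]
    by (simp add: case_prod_beta)
  finally show ?thesis .
qed

text \<open>An infinite set has infinitely many subsets, and a sum over an infinite set is 0 by
  default.\<close>

lemma smul_infinite:
  assumes "infinite (snd \<mu>)"
  shows "smul f g \<mu> = 0"
  using assms by (simp add: smul_def case_prod_beta)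

lemma mono_splits_finite:
  assumes "finite (snd \<mu>)" "z \<in> mono_splits \<mu>"
  shows "finite (snd (fst z))" "finite (snd (snd z))"
  using assms by (auto simp: mono_splits_def dest: sym[of _ "snd \<mu>"])

text \<open>Both sides sum over the ways to split a monomial into three factors. By multiplicativity
  of \<open>osign\<close>, either bracketing carries the product of the three pairwise
  signs.\<close>

lemma smul_assoc: "smul (smul f g) h = smul f (smul g h)"
proof
  fix \<mu> :: mono
  show "smul (smul f g) h \<mu> = smul f (smul g h) \<mu>"
  proof (cases "finite (snd \<mu>)")
    case fin: True
    let ?s = "\<lambda>\<alpha> \<beta> :: mono. osign (snd \<alpha>) (snd \<beta>)"
    let ?L = "\<lambda>p q. f (fst q) * g (snd q) * ?s (fst q) (snd q) * h (snd p) * ?s (fst p) (snd p)"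
    let ?R = "\<lambda>p q. f (fst p) * (g (fst q) * h (snd q) * ?s (fst q) (snd q)) * ?s (fst p) (snd p)"
    note fins = fin finite_mono_splits mono_splits_finite[OF fin]
    have "smul (smul f g) h \<mu> = (\<Sum>p\<in>mono_splits \<mu>. \<Sum>q\<in>mono_splits (fst p). ?L p q)"
      unfolding smul_splits[OF fin]
      by (rule sum.cong) (simp_all add: smul_splits fins sum_distrib_right case_prod_beta)
    also have "\<dots> = (\<Sum>(p, q)\<in>(SIGMA p:mono_splits \<mu>. mono_splits (fst p)). ?L p q)"
      by (rule sum.Sigma) (simp_all add: fins)
    also have "\<dots> = (\<Sum>(p, q)\<in>(SIGMA p:mono_splits \<mu>. mono_splits (snd p)). ?R p q)"
    proof (rule sum.reindex_bij_witness[where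
          j = "\<lambda>((\<nu>, \<gamma>), (\<alpha>, \<beta>)). ((\<alpha>, (fst \<beta> + fst \<gamma>, snd \<beta> \<union> snd \<gamma>)), (\<beta>, \<gamma>))" and
          i = "\<lambda>((\<alpha>, \<delta>), (\<beta>, \<gamma>)). (((fst \<alpha> + fst \<beta>, snd \<alpha> \<union> snd \<beta>), \<gamma>), (\<alpha>, \<beta>))"], goal_cases)
      case (5 z)
      obtain \<nu> \<gamma> \<alpha> \<beta> where z: "z = ((\<nu>, \<gamma>), (\<alpha>, \<beta>))" by (metis prod.exhaust_sel)
      have *: "(\<nu>, \<gamma>) \<in> mono_splits \<mu>" "(\<alpha>, \<beta>) \<in> mono_splits \<nu>" using 5 z by auto
      then have F: "finite (snd \<alpha>)" "finite (snd \<beta>)" "finite (snd \<gamma>)"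
        using fin mono_splits_finite by (metis fst_conv snd_conv)+
      have d: "snd \<alpha> \<inter> snd \<beta> = {}" "snd \<beta> \<inter> snd \<gamma> = {}" and \<nu>: "snd \<nu> = snd \<alpha> \<union> snd \<beta>"
        using * by (auto simp: mono_splits_def)
      show ?case
        by (simp add: z \<nu> osign_union_left osign_union_right d F)
    qed (auto simp: mono_splits_def add.assoc prod_eq_iff)
    also have "\<dots> = (\<Sum>p\<in>mono_splits \<mu>. \<Sum>q\<in>mono_splits (snd p). ?R p q)"
      by (rule sum.Sigma[symmetric]) (simp_all add: fins)
    also have "\<dots> = smul f (smul g h) \<mu>"
      unfolding smul_splits[OF fin]
      by (rule sum.cong)
        (simp_all add: smul_splits fins sum_distrib_right sum_distrib_left case_prod_beta)
    finally show ?thesis .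
  qed (simp add: smul_infinite)
qed

text \<open>On an infinite set of odd variables \<^const>\<open>smul\<close> is 0 by junk values, so
  \<^const>\<open>sone\<close> is a unit only for series without such monomials.\<close>

typedef gseries = "{f :: series. \<forall>\<mu>. infinite (snd \<mu>) \<longrightarrow> f \<mu> = 0}"
  morphisms coeff Gseries
  by auto

setup_lifting type_definition_gseries

lemma gseries_eqI: "(\<And>\<mu>. finite (snd \<mu>) \<Longrightarrow> coeff f \<mu> = coeff g \<mu>) \<Longrightarrow> f = g"
  by transfer (auto simp: fun_eq_iff, metis snd_conv)

lemma coeff_infinite: "infinite (snd \<mu>) \<Longrightarrow> coeff f \<mu> = 0"
  by transfer auto

lemma coeff_Gseries:
  "(\<And>\<mu>. infinite (snd \<mu>) \<Longrightarrow> f \<mu> = 0) \<Longrightarrow> coeff (Gseries f) = f"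
  by (simp add: Gseries_inverse)

lemma smul_one_left:
  assumes "\<forall>\<mu>. infinite (snd \<mu>) \<longrightarrow> f \<mu> = 0"
  shows "smul sone f = f"
proof
  fix \<mu>
  show "smul sone f \<mu> = f \<mu>"
  proof (cases "finite (snd \<mu>)")
    case True
    have "smul sone f \<mu> = (\<Sum>(\<alpha>, \<beta>)\<in>{(({#}, {}), \<mu>)}. sone \<alpha> * f \<beta> * osign (snd \<alpha>) (snd \<beta>))"
      unfolding smul_splits[OF True]
      by (rule sum.mono_neutral_right) (auto simp: finite_mono_splits True, auto simp: mono_splits_def sone_def split: if_splits)
    then show ?thesis by (simp add: sone_def)
  qed (use assms in \<open>simp add: smul_infinite del: split_paired_All\<close>)
qed

lemma smul_one_right:
  assumes "\<forall>\<mu>. infinite (snd \<mu>) \<longrightarrow> f \<mu> = 0"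
  shows "smul f sone = f"
proof
  fix \<mu>
  show "smul f sone \<mu> = f \<mu>"
  proof (cases "finite (snd \<mu>)")
    case True
    have "smul f sone \<mu> = (\<Sum>(\<alpha>, \<beta>)\<in>{(\<mu>, ({#}, {}))}. f \<alpha> * sone \<beta> * osign (snd \<alpha>) (snd \<beta>))"
      unfolding smul_splits[OF True]
      by (rule sum.mono_neutral_right) (auto simp: finite_mono_splits True, auto simp: mono_splits_def sone_def split: if_splits)
    then show ?thesis by (simp add: sone_def)
  qed (use assms in \<open>simp add: smul_infinite del: split_paired_All\<close>)
qed

text \<open>The algebra is not commutative. Arguments that need a commutative ring are carried out
  in its centre further down.\<close>

instantiation gseries :: real_algebra_1
begin

lift_definition zero_gseries :: gseries is "\<lambda>_. 0" by simp
lift_definition one_gseries :: gseries is sone by (auto simp: sone_def)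
lift_definition plus_gseries :: "gseries \<Rightarrow> gseries \<Rightarrow> gseries" is "\<lambda>f g \<mu>. f \<mu> + g \<mu>" by auto
lift_definition minus_gseries :: "gseries \<Rightarrow> gseries \<Rightarrow> gseries" is "\<lambda>f g \<mu>. f \<mu> - g \<mu>" by auto
lift_definition uminus_gseries :: "gseries \<Rightarrow> gseries" is "\<lambda>f \<mu>. - f \<mu>" by auto
lift_definition scaleR_gseries :: "real \<Rightarrow> gseries \<Rightarrow> gseries" is "\<lambda>c f \<mu>. c * f \<mu>" by auto
lift_definition times_gseries :: "gseries \<Rightarrow> gseries \<Rightarrow> gseries" is smul
  by (auto simp: smul_infinite)

instance
proof
  fix f g h :: gseries and c d :: real
  show "f + g + h = f + (g + h)" by transfer (simp add: add.assoc)
  show "f + g = g + f" by transfer (simp add: add.commute)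
  show "0 + f = f" by transfer simp
  show "- f + f = 0" by transfer simp
  show "f - g = f + - g" by transfer simp
  show "f * g * h = f * (g * h)" by transfer (simp add: smul_assoc)
  show "1 * f = f" by transfer (simp add: smul_one_left)
  show "f * 1 = f" by transfer (simp add: smul_one_right)
  show "(f + g) * h = f * h + g * h"
    by transfer (auto simp: smul_def fun_eq_iff algebra_simps sum.distrib)
  show "f * (g + h) = f * g + f * h"
    by transfer (auto simp: smul_def fun_eq_iff algebra_simps sum.distrib)
  show "(0 :: gseries) \<noteq> 1"
    by transfer (auto simp: sone_def fun_eq_iff)
  show "c *\<^sub>R (f + g) = c *\<^sub>R f + c *\<^sub>R g" by transfer (simp add: algebra_simps)
  show "(c + d) *\<^sub>R f = c *\<^sub>R f + d *\<^sub>R f" by transfer (simp add: algebra_simps)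
  show "c *\<^sub>R d *\<^sub>R f = (c * d) *\<^sub>R f" by transfer (simp add: mult.assoc)
  show "1 *\<^sub>R f = f" by transfer simp
  show "c *\<^sub>R f * g = c *\<^sub>R (f * g)"
    by transfer (auto simp: smul_def fun_eq_iff sum_distrib_left mult.assoc)
  show "f * c *\<^sub>R g = c *\<^sub>R (f * g)"
    by transfer (auto simp: smul_def fun_eq_iff sum_distrib_left algebra_simps)
qed

end

lemma coeff_simps [simp]:
  "coeff 0 \<mu> = 0" "coeff (f + g) \<mu> = coeff f \<mu> + coeff g \<mu>" "coeff (- f) \<mu> = - coeff f \<mu>"
  "coeff (f - g) \<mu> = coeff f \<mu> - coeff g \<mu>" "coeff (c *\<^sub>R f) \<mu> = c * coeff f \<mu>"
  by (transfer, simp)+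

lemma coeff_sum [simp]: "coeff (\<Sum>i\<in>A. f i) \<mu> = (\<Sum>i\<in>A. coeff (f i) \<mu>)"
  by (induction A rule: infinite_finite_induct) auto

lemma coeff_power: "coeff (f ^ k) = spow (coeff f) k"
  by (induction k) (simp_all add: one_gseries.rep_eq times_gseries.rep_eq)

lemma coeff_prod_list: "coeff (prod_list fs) = foldr smul (map coeff fs) sone"
  by (induction fs) (simp_all add: one_gseries.rep_eq times_gseries.rep_eq)

lemma coeff_times:
  "finite (snd \<mu>) \<Longrightarrow>
    coeff (f * g) \<mu> = (\<Sum>(\<alpha>, \<beta>)\<in>mono_splits \<mu>. coeff f \<alpha> * coeff g \<beta> * osign (snd \<alpha>) (snd \<beta>))"
  by (simp add: times_gseries.rep_eq smul_splits)

lift_definition even_var :: "evar \<Rightarrow> gseries" is seven by (auto simp: seven_def)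
lift_definition odd_var :: "ovar \<Rightarrow> gseries" is sodd by (auto simp: sodd_def)

section \<open>Supercommutation\<close>

text \<open>Homogeneity for the grading modulo 2 by the number of odd variables. The degree is a
  natural number so that degrees of factors can be added; the zero series has every parity.\<close>

definition parity :: "nat \<Rightarrow> gseries \<Rightarrow> bool" where
  "parity e f \<longleftrightarrow> (\<forall>\<mu>. coeff f \<mu> \<noteq> 0 \<longrightarrow> even (card (snd \<mu>) + e))"

lemma parity_even_var: "parity 0 (even_var v)"
  by (auto simp: parity_def even_var.rep_eq seven_def)

lemma parity_odd_var: "parity 1 (odd_var w)"
  by (auto simp: parity_def odd_var.rep_eq sodd_def split: if_splits)

lemma parity_one: "parity 0 1"
  by (auto simp: parity_def one_gseries.rep_eq sone_def split: if_splits)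

lemma parity_sum: "(\<And>i. i \<in> A \<Longrightarrow> parity e (f i)) \<Longrightarrow> parity e (\<Sum>i\<in>A. f i)"
  unfolding parity_def coeff_sum by (meson sum.not_neutral_contains_not_neutral)

lemma parity_times:
  assumes "parity e f" "parity e' g"
  shows "parity (e + e') (f * g)"
  unfolding parity_def
proof (intro allI impI)
  fix \<mu> assume nz: "coeff (f * g) \<mu> \<noteq> 0"
  then have fin: "finite (snd \<mu>)" using coeff_infinite by blast
  from nz obtain z where z: "z \<in> mono_splits \<mu>" "coeff f (fst z) \<noteq> 0" "coeff g (snd z) \<noteq> 0"
    unfolding coeff_times[OF fin] by (auto elim!: sum.not_neutral_contains_not_neutral)
  have "card (snd \<mu>) = card (snd (fst z)) + card (snd (snd z))"
    using z(1) mono_splits_finite[OF fin z(1)] by (auto simp: mono_splits_def simp flip: card_Un_disjoint)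
  then show "even (card (snd \<mu>) + (e + e'))"
    using assms z(2,3) unfolding parity_def by (metis even_add)
qed

lemma parity_power: "parity 0 f \<Longrightarrow> parity 0 (f ^ n)"
  by (induction n) (use parity_one parity_times[of 0 f 0] in auto)

lemma parity_prod_list:
  "(\<And>p. p \<in> set ps \<Longrightarrow> parity (e p) (f p)) \<Longrightarrow> parity (\<Sum>p\<leftarrow>ps. e p) (\<Prod>p\<leftarrow>ps. f p)"
  by (induction ps) (auto simp: parity_one parity_times)

text \<open>Exchanging the two components permutes the splittings of a monomial, and
  \<open>osign_swap\<close> gives the sign of each exchange. Both commutation rules are read off
  from this form.\<close>

lemma coeff_times_swap:
  assumes "finite (snd \<mu>)"
  shows "coeff (g * f) \<mu> = (\<Sum>(\<alpha>, \<beta>)\<in>mono_splits \<mu>.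
    (-1) ^ (card (snd \<alpha>) * card (snd \<beta>)) * (coeff f \<alpha> * coeff g \<beta> * osign (snd \<alpha>) (snd \<beta>)))"
  unfolding coeff_times[OF assms]
proof (rule sum.reindex_bij_witness[where i = prod.swap and j = prod.swap], goal_cases)
  case (5 z)
  then have "snd (fst z) \<inter> snd (snd z) = {}" by (auto simp: mono_splits_def)
  then show ?case
    using osign_swap[of "snd (snd z)" "snd (fst z)"] mono_splits_finite[OF assms 5]
    by (simp add: case_prod_beta ac_simps)
qed (auto simp: mono_splits_def ac_simps)

text \<open>Only splittings with an even number of odd variables in the first component contribute,
  and their sign is 1. As \<open>g\<close> need not be homogeneous, \<open>f\<close> is
  central.\<close>

lemma even_commute:
  assumes "parity 0 f"
  shows "f * g = g * f"
proof (rule gseries_eqI)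
  fix \<mu> :: mono assume fin: "finite (snd \<mu>)"
  show "coeff (f * g) \<mu> = coeff (g * f) \<mu>"
    unfolding coeff_times_swap[OF fin, of g f] coeff_times[OF fin, of f g]
    by (rule sum.cong) (use assms in \<open>auto simp: parity_def\<close>)
qed

lemma supercommute:
  assumes "parity e f" "parity e' g"
  shows "g * f = (-1) ^ (e * e') *\<^sub>R (f * g)"
proof (rule gseries_eqI)
  fix \<mu> :: mono assume fin: "finite (snd \<mu>)"
  have sign: "(-1) ^ (card (snd \<alpha>) * card (snd \<beta>)) * (coeff f \<alpha> * coeff g \<beta> * osign (snd \<alpha>) (snd \<beta>))
      = (-1) ^ (e * e') * (coeff f \<alpha> * coeff g \<beta> * osign (snd \<alpha>) (snd \<beta>))" for \<alpha> \<beta>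
  proof (cases "coeff f \<alpha> = 0 \<or> coeff g \<beta> = 0")
    case False
    then have "even (card (snd \<alpha>) * card (snd \<beta>)) \<longleftrightarrow> even (e * e')"
      using assms unfolding parity_def by (metis even_add even_mult_iff)
    then show ?thesis by (simp add: minus_one_power_iff)
  qed auto
  show "coeff (g * f) \<mu> = coeff ((-1) ^ (e * e') *\<^sub>R (f * g)) \<mu>"
    unfolding coeff_times_swap[OF fin, of g f] coeff_simps coeff_times[OF fin, of f g]
    by (simp only: sum_distrib_left sign case_prod_unfold)
qed

lemma odd_square:
  assumes "parity 1 f"
  shows "f * f = 0"
proof -
  have "f * f = - (f * f)" using supercommute[OF assms assms] by simp
  then have "2 *\<^sub>R (f * f) = 0" by (simp add: scaleR_2 eq_neg_iff_add_eq_0)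
  then show ?thesis by simp
qed

lemma choose_two_add: "(m + n) choose 2 = (m choose 2) + m * n + (n choose 2)"
  by (induction m) (simp_all add: numeral_2_eq_2)

text \<open>Moving the second factor of the first pair past the first factors of all
  later pairs costs the sign \<open>(-1) ^ (e p * s)\<close> with \<open>s\<close> the sum of the later degrees,
  and \<open>e p * s = ((e p + s) choose 2) - (e p choose 2) - (s choose 2)\<close>.\<close>

lemma prod_list_interleave:
  assumes "\<And>p. p \<in> set ps \<Longrightarrow> parity (e p) (A p)" "\<And>p. p \<in> set ps \<Longrightarrow> parity (e p) (B p)"
  shows "(\<Prod>p\<leftarrow>ps. A p) * (\<Prod>p\<leftarrow>ps. B p) =
    (-1) ^ ((\<Sum>p\<leftarrow>ps. e p) choose 2) *\<^sub>R (\<Prod>p\<leftarrow>ps. (-1) ^ (e p choose 2) *\<^sub>R (A p * B p))"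
  using assms
proof (induction ps)
  case (Cons p ps)
  let ?s = "\<Sum>p\<leftarrow>ps. e p" and ?A = "\<Prod>p\<leftarrow>ps. A p" and ?B = "\<Prod>p\<leftarrow>ps. B p"
  have "?A * B p = (-1) ^ (e p * ?s) *\<^sub>R (B p * ?A)"
    using Cons.prems parity_prod_list[of ps e A] by (intro supercommute) auto
  then have "A p * ?A * (B p * ?B) = (-1) ^ (e p * ?s) *\<^sub>R (A p * B p * (?A * ?B))"
    by (simp add: mult.assoc) (metis mult.assoc mult_scaleR_left mult_scaleR_right)
  also have "?A * ?B = (-1) ^ (?s choose 2) *\<^sub>R (\<Prod>p\<leftarrow>ps. (-1) ^ (e p choose 2) *\<^sub>R (A p * B p))"
    using Cons by simp
  finally show ?case
    by (simp add: choose_two_add power_add mult_ac minus_one_power_iff)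
qed (simp add: numeral_2_eq_2)

section \<open>The centre of an algebra\<close>

typedef (overloaded) 'a centre = "{x :: 'a :: real_algebra_1. \<forall>y. x * y = y * x}"
  morphisms of_centre Centre
  by (rule exI[of _ 1]) simp

setup_lifting type_definition_centre

instantiation centre :: (real_algebra_1) "{comm_ring_1, real_algebra_1}"
begin

lift_definition zero_centre :: "'a centre" is 0 by simp
lift_definition one_centre :: "'a centre" is 1 by simp
lift_definition plus_centre :: "'a centre \<Rightarrow> 'a centre \<Rightarrow> 'a centre" is "(+)"
  by (simp add: algebra_simps)
lift_definition minus_centre :: "'a centre \<Rightarrow> 'a centre \<Rightarrow> 'a centre" is "(-)"
  by (simp add: algebra_simps)
lift_definition uminus_centre :: "'a centre \<Rightarrow> 'a centre" is uminus
  by simp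
lift_definition scaleR_centre :: "real \<Rightarrow> 'a centre \<Rightarrow> 'a centre" is "(*\<^sub>R)"
  by simp
lift_definition times_centre :: "'a centre \<Rightarrow> 'a centre \<Rightarrow> 'a centre" is "(*)"
proof -
  fix x y z :: 'a
  assume x: "\<And>z. x * z = z * x" and y: "\<And>z. y * z = z * y"
  have "x * y * z = x * z * y" by (simp add: mult.assoc y)
  also have "\<dots> = z * (x * y)" by (simp add: mult.assoc x[of z])
  finally show "x * y * z = z * (x * y)" .
qed

instance
proof
  fix x y z :: "'a centre" and c d :: real
  show "x + y + z = x + (y + z)" by transfer (simp add: add.assoc)
  show "x + y = y + x" by transfer (simp add: add.commute)
  show "0 + x = x" by transfer simp
  show "- x + x = 0" by transfer simp
  show "x - y = x + - y" by transfer simp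
  show "x * y * z = x * (y * z)" by transfer (rule mult.assoc)
  show "x * y = y * x" by transfer blast
  show "1 * x = x" by transfer simp
  show "x * 1 = x" by transfer simp
  show "(x + y) * z = x * z + y * z" by transfer (rule distrib_right)
  show "x * (y + z) = x * y + x * z" by transfer (rule distrib_left)
  show "(0 :: 'a centre) \<noteq> 1" by transfer simp
  show "c *\<^sub>R (x + y) = c *\<^sub>R x + c *\<^sub>R y" by transfer (rule scaleR_add_right)
  show "(c + d) *\<^sub>R x = c *\<^sub>R x + d *\<^sub>R x" by transfer (rule scaleR_add_left)
  show "c *\<^sub>R d *\<^sub>R x = (c * d) *\<^sub>R x" by transfer simp
  show "1 *\<^sub>R x = x" by transfer simp
  show "c *\<^sub>R x * y = c *\<^sub>R (x * y)" by transfer (rule mult_scaleR_left)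
  show "x * c *\<^sub>R y = c *\<^sub>R (x * y)" by transfer (rule mult_scaleR_right)
qed

end

lemma of_centre_inject: "of_centre x = of_centre y \<longleftrightarrow> x = y"
  by transfer simp

lemma of_centre_simps [simp]:
  "of_centre 0 = 0" "of_centre 1 = 1" "of_centre (x + y) = of_centre x + of_centre y"
  "of_centre (x * y) = of_centre x * of_centre y" "of_centre (c *\<^sub>R x) = c *\<^sub>R of_centre x"
  by (transfer, rule refl)+

lemma of_centre_power: "of_centre (x ^ n) = of_centre x ^ n"
  by (induction n) simp_all

lemma of_centre_sum: "of_centre (\<Sum>i\<in>A. f i) = (\<Sum>i\<in>A. of_centre (f i))"
  by (induction A rule: infinite_finite_induct) simp_all

lemma of_centre_prod_list: "of_centre (\<Prod>i\<leftarrow>is. f i) = (\<Prod>i\<leftarrow>is. of_centre (f i))"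
  by (induction "is") simp_all

lemma of_centre_Centre: "(\<And>y. x * y = y * x) \<Longrightarrow> of_centre (Centre x) = x"
  by (rule Centre_inverse) simp

section \<open>Complete homogeneous functions and exponentials\<close>

text \<open>The coefficient of \<open>t ^ d\<close> in the product of the series
  \<open>1 / (1 - u t)\<close>. The variable \<open>t\<close> only records the degree and is
  separate from the variables of the series.\<close>

definition complete_sym :: "'a :: comm_ring_1 list \<Rightarrow> nat \<Rightarrow> 'a" where
  "complete_sym us d = fps_nth (\<Prod>u\<leftarrow>us. Abs_fps (\<lambda>k. u ^ k)) d"

lemma complete_sym_Nil: "complete_sym [] d = (if d = 0 then 1 else 0)"
  by (simp add: complete_sym_def)

lemma complete_sym_Cons: "complete_sym (u # us) d = (\<Sum>k\<le>d. u ^ k * complete_sym us (d - k))"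
  by (simp add: complete_sym_def fps_mult_nth atLeast0AtMost)

lemma complete_sym_0: "complete_sym us 0 = 1"
  by (induction us) (simp_all add: complete_sym_Nil complete_sym_Cons)

text \<open>This is \<open>G' = u G^2\<close> for \<open>G = 1 / (1 - u t)\<close>, checked on
  coefficients: that of \<open>t ^ n\<close> in \<open>G^2\<close> is
  \<open>(n + 1) u ^ n\<close>.\<close>

lemma fps_deriv_geometric:
  fixes u :: "'a :: comm_ring_1"
  defines "G \<equiv> Abs_fps (\<lambda>k. u ^ k)"
  shows "fps_deriv G = G * (fps_const u * G)"
proof (rule fps_ext)
  fix n
  have "fps_nth (G * G) n = (\<Sum>i=0..n. u ^ n)"
    unfolding fps_mult_nth by (rule sum.cong) (auto simp: G_def simp flip: power_add)
  then have "fps_nth (fps_const u * (G * G)) n = of_nat (n + 1) * u ^ (n + 1)"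
    unfolding fps_mult_left_const_nth by (simp add: algebra_simps)
  then show "fps_nth (fps_deriv G) n = fps_nth (G * (fps_const u * G)) n"
    by (simp add: mult.left_commute G_def)
qed

text \<open>Newton's identity: the logarithmic derivative of the product of the
  \<open>1 / (1 - u t)\<close> is the sum of the \<open>u / (1 - u t)\<close>, the generating
  function of the power sums; coefficients of \<open>t ^ n\<close> are compared.\<close>

lemma complete_sym_recurrence:
  "of_nat (Suc n) * complete_sym us (Suc n) =
    (\<Sum>k\<le>n. (\<Sum>u\<leftarrow>us. u ^ Suc k) * complete_sym us (n - k))"
proof -
  let ?G = "\<lambda>u :: 'a. Abs_fps (\<lambda>k. u ^ k)"
  have "fps_deriv (\<Prod>u\<leftarrow>us. ?G u) = (\<Sum>u\<leftarrow>us. fps_const u * ?G u) * (\<Prod>u\<leftarrow>us. ?G u)"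
    by (induction us) (simp_all add: fps_deriv_geometric algebra_simps)
  then have "fps_nth (fps_deriv (\<Prod>u\<leftarrow>us. ?G u)) n =
      fps_nth ((\<Sum>u\<leftarrow>us. fps_const u * ?G u) * (\<Prod>u\<leftarrow>us. ?G u)) n"
    by simp
  moreover have "fps_nth (\<Sum>u\<leftarrow>us. fps_const u * ?G u) k = (\<Sum>u\<leftarrow>us. u ^ Suc k)" for k
    by (induction us) simp_all
  ultimately show ?thesis
    by (simp add: complete_sym_def fps_mult_nth atLeast0AtMost)
qed

section \<open>Exponential sums over multisets\<close>

definition weighted_msets :: "('p \<Rightarrow> nat) \<Rightarrow> 'p set \<Rightarrow> nat \<Rightarrow> 'p multiset set" where
  "weighted_msets w P d = {\<Lambda>. set_mset \<Lambda> \<subseteq> P \<and> (\<Sum>p\<in>#\<Lambda>. w p) = d}"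

text \<open>The term that belongs to the multiset in the expansion of the product of the
  exponentials \<open>exp (a p)\<close>.\<close>

definition exp_term :: "('p \<Rightarrow> 'a) \<Rightarrow> 'p multiset \<Rightarrow> 'a :: {comm_ring_1, real_algebra_1}" where
  "exp_term a \<Lambda> = (1 / (\<Prod>p\<in>set_mset \<Lambda>. fact (count \<Lambda> p))) *\<^sub>R (\<Prod>p\<in>#\<Lambda>. a p)"

text \<open>Positive weights bound both the size of the multiset and the weight of each element by
  \<open>d\<close>, leaving lists of bounded length over a finite set.\<close>

lemma finite_weighted_msets:
  assumes pos: "\<And>p. p \<in> P \<Longrightarrow> 0 < w p" and fin: "\<And>k. finite {p \<in> P. w p \<le> k}"
  shows "finite (weighted_msets w P d)"
proof (rule finite_subset)
  show "finite (mset ` {xs. set xs \<subseteq> {p \<in> P. w p \<le> d} \<and> length xs \<le> d})"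
    by (intro finite_imageI finite_lists_length_le fin)
  show "weighted_msets w P d \<subseteq> mset ` {xs. set xs \<subseteq> {p \<in> P. w p \<le> d} \<and> length xs \<le> d}"
  proof
    fix \<Lambda> assume \<Lambda>: "\<Lambda> \<in> weighted_msets w P d"
    have "size \<Lambda> \<le> (\<Sum>p\<in>#\<Lambda>. w p)" if "set_mset \<Lambda> \<subseteq> P" for \<Lambda>
      using that by (induction \<Lambda>) (auto dest: pos)
    then have "size \<Lambda> \<le> d" using \<Lambda> by (auto simp: weighted_msets_def)
    moreover have "w p \<le> d" if "p \<in># \<Lambda>" for p
      using that \<Lambda> by (auto simp: weighted_msets_def dest!: multi_member_split)
    moreover obtain xs where "\<Lambda> = mset xs" by (metis ex_mset)
    ultimately show "\<Lambda> \<in> mset ` {xs. set xs \<subseteq> {p \<in> P. w p \<le> d} \<and> length xs \<le> d}"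
      using \<Lambda> by (auto simp: weighted_msets_def intro!: imageI)
  qed
qed

lemma prod_fact_count_add_mset:
  "(\<Prod>q\<in>set_mset (add_mset p \<Lambda>). fact (count (add_mset p \<Lambda>) q)) =
    real (Suc (count \<Lambda> p)) * (\<Prod>q\<in>set_mset \<Lambda>. fact (count \<Lambda> q))"
proof -
  let ?S = "set_mset \<Lambda> - {p}"
  have rest: "(\<Prod>q\<in>?S. fact (count (add_mset p \<Lambda>) q)) = (\<Prod>q\<in>?S. fact (count \<Lambda> q) :: real)"
    by (rule prod.cong) auto
  have "(\<Prod>q\<in>set_mset \<Lambda>. fact (count \<Lambda> q) :: real) = (\<Prod>q\<in>insert p (set_mset \<Lambda>). fact (count \<Lambda> q))"
    by (cases "p \<in># \<Lambda>") (simp_all add: insert_absorb not_in_iff)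
  also have "\<dots> = fact (count \<Lambda> p) * (\<Prod>q\<in>?S. fact (count \<Lambda> q))"
    by (rule prod.insert_remove) simp
  moreover have "(\<Prod>q\<in>set_mset (add_mset p \<Lambda>). fact (count (add_mset p \<Lambda>) q) :: real) =
      fact (Suc (count \<Lambda> p)) * (\<Prod>q\<in>?S. fact (count (add_mset p \<Lambda>) q))"
    unfolding set_mset_add_mset_insert by (subst prod.insert_remove) simp_all
  ultimately show ?thesis unfolding rest by simp
qed

lemma of_nat_mult_scaleR: "of_nat n * x = real n *\<^sub>R (x :: 'a :: real_algebra_1)"
  by (simp add: scaleR_conv_of_real)

lemma exp_term_add_mset:
  "of_nat (Suc (count \<Lambda> p)) * exp_term a (add_mset p \<Lambda>) = a p * exp_term a \<Lambda>"
  unfolding exp_term_def prod_fact_count_add_mset of_nat_mult_scaleR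
  by (simp del: of_nat_Suc)

lemma sum_mset_image_mset_count:
  fixes w :: "'p \<Rightarrow> nat"
  assumes "finite S" "set_mset \<Lambda> \<subseteq> S"
  shows "(\<Sum>p\<in>#\<Lambda>. w p) = (\<Sum>p\<in>S. count \<Lambda> p * w p)"
  using assms(2)
proof (induction \<Lambda>)
  case (add p \<Lambda>)
  have "(\<Sum>q\<in>S. count (add_mset p \<Lambda>) q * w q) =
      (\<Sum>q\<in>S. count \<Lambda> q * w q + (if q = p then w q else 0))"
    by (rule sum.cong) auto
  then show ?case using add assms(1) by (simp add: sum.distrib)
qed simp

text \<open>The factor \<open>Suc n\<close> is written as the sum of
  \<open>count \<Lambda> p * w p\<close>, and the multiplicity is absorbed by removing one copy of
  \<open>p\<close>. Pairs of a multiset and an element of it then correspond to pairs of an element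
  and the smaller multiset.\<close>

lemma exp_term_recurrence:
  fixes a :: "'p \<Rightarrow> 'a :: {comm_ring_1, real_algebra_1}"
  assumes pos: "\<And>p. p \<in> P \<Longrightarrow> 0 < w p" and fin: "\<And>k. finite {p \<in> P. w p \<le> k}"
  defines "H \<equiv> \<lambda>d. \<Sum>\<Lambda>\<in>weighted_msets w P d. exp_term a \<Lambda>"
  shows "of_nat (Suc n) * H (Suc n) =
    (\<Sum>k\<le>n. (of_nat (Suc k) * (\<Sum>p | p \<in> P \<and> w p = Suc k. a p)) * H (n - k))"
proof -
  let ?W = "weighted_msets w P" and ?P = "{p \<in> P. w p \<le> Suc n}"
  have finW: "finite (?W d)" for d using finite_weighted_msets[OF pos fin] .
  have "of_nat (Suc n) * exp_term a \<Lambda> = (\<Sum>p\<in>set_mset \<Lambda>. of_nat (w p) * (a p * exp_term a (\<Lambda> - {#p#})))"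
    if \<Lambda>: "\<Lambda> \<in> ?W (Suc n)" for \<Lambda>
  proof -
    have "Suc n = (\<Sum>p\<in>set_mset \<Lambda>. count \<Lambda> p * w p)"
      using \<Lambda> by (simp add: weighted_msets_def sum_mset_image_mset_count[OF finite_set_mset order_refl])
    then have "of_nat (Suc n) * exp_term a \<Lambda> =
        (\<Sum>p\<in>set_mset \<Lambda>. of_nat (w p) * (of_nat (count \<Lambda> p) * exp_term a \<Lambda>))"
      by (simp only: of_nat_sum of_nat_mult sum_distrib_right mult.assoc mult.left_commute)
    also have "\<dots> = (\<Sum>p\<in>set_mset \<Lambda>. of_nat (w p) * (a p * exp_term a (\<Lambda> - {#p#})))"
    proof (rule sum.cong)
      fix p assume "p \<in># \<Lambda>"
      then obtain \<Lambda>' where "\<Lambda> = add_mset p \<Lambda>'" by (metis insert_DiffM)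
      then show "of_nat (w p) * (of_nat (count \<Lambda> p) * exp_term a \<Lambda>) =
          of_nat (w p) * (a p * exp_term a (\<Lambda> - {#p#}))"
        using exp_term_add_mset[of \<Lambda>' p a] by simp
    qed simp
    finally show ?thesis .
  qed
  then have "of_nat (Suc n) * H (Suc n) =
      (\<Sum>\<Lambda>\<in>?W (Suc n). \<Sum>p\<in>set_mset \<Lambda>. of_nat (w p) * (a p * exp_term a (\<Lambda> - {#p#})))"
    unfolding H_def sum_distrib_left by (rule sum.cong[OF refl])
  also have "\<dots> = (\<Sum>(\<Lambda>, p)\<in>(SIGMA \<Lambda>:?W (Suc n). set_mset \<Lambda>).
      of_nat (w p) * (a p * exp_term a (\<Lambda> - {#p#})))"
    by (rule sum.Sigma) (simp_all add: finW)
  also have "\<dots> = (\<Sum>(p, \<Lambda>)\<in>(SIGMA p:?P. ?W (Suc n - w p)). of_nat (w p) * (a p * exp_term a \<Lambda>))"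
  proof (rule sum.reindex_bij_witness[where i = "\<lambda>(p, \<Lambda>). (add_mset p \<Lambda>, p)" and
        j = "\<lambda>(\<Lambda>, p). (p, \<Lambda> - {#p#})"], goal_cases)
    case (2 z)
    then show ?case
      by (auto simp: weighted_msets_def dest: in_diffD dest!: multi_member_split)
  qed (auto simp: weighted_msets_def)
  also have "\<dots> = (\<Sum>p\<in>?P. \<Sum>\<Lambda>\<in>?W (Suc n - w p). of_nat (w p) * (a p * exp_term a \<Lambda>))"
    by (rule sum.Sigma[symmetric]) (simp_all add: finW fin)
  also have "\<dots> = (\<Sum>p\<in>?P. of_nat (w p) * a p * H (Suc n - w p))"
    by (simp add: H_def sum_distrib_left mult.assoc)
  \<comment> \<open>Grouping by \<open>w p - 1\<close> is grouping by weight, shifted to start at 0;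
    positivity of the weights keeps truncated subtraction from merging weights 0 and 1.\<close>
  also have "\<dots> = (\<Sum>k\<in>{..n}. \<Sum>p | p \<in> ?P \<and> w p - 1 = k. of_nat (w p) * a p * H (Suc n - w p))"
    by (rule sum.group[symmetric]) (auto simp: fin)
  also have "\<dots> = (\<Sum>k\<le>n. \<Sum>p | p \<in> P \<and> w p = Suc k. of_nat (Suc k) * a p * H (n - k))"
  proof (intro sum.cong refl)
    fix k assume "k \<in> {..n}"
    then show "{p. p \<in> ?P \<and> w p - 1 = k} = {p. p \<in> P \<and> w p = Suc k}"
      using pos by force
  qed auto
  finally show ?thesis
    by (simp add: sum_distrib_left sum_distrib_right)
qed

text \<open>In a real algebra the factor \<open>Suc n\<close> can be cancelled, so each value is
  determined by the earlier ones.\<close>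

lemma recurrence_unique:
  fixes f g :: "nat \<Rightarrow> 'a :: real_algebra_1"
  assumes "f 0 = g 0"
    and "\<And>n. of_nat (Suc n) * f (Suc n) = (\<Sum>k\<le>n. q k * f (n - k))"
    and "\<And>n. of_nat (Suc n) * g (Suc n) = (\<Sum>k\<le>n. q k * g (n - k))"
  shows "f d = g d"
proof (induction d rule: less_induct)
  case (less d)
  show ?case
  proof (cases d)
    case (Suc n)
    have "of_nat (Suc n) * f (Suc n) = of_nat (Suc n) * g (Suc n)"
      unfolding assms(2,3) by (rule sum.cong) (auto simp: less Suc)
    then have "real (Suc n) *\<^sub>R f (Suc n) = real (Suc n) *\<^sub>R g (Suc n)"
      by (simp only: of_nat_mult_scaleR)
    then show ?thesis using Suc by (simp del: of_nat_Suc)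
  qed (use assms(1) in simp)
qed

text \<open>The hypothesis on power sums says that the logarithm of the product of the
  \<open>1 / (1 - u t)\<close> is the sum of the \<open>a p * t ^ w p\<close>; the conclusion
  compares coefficients after exponentiating.\<close>

lemma complete_sym_eq_exp:
  fixes a :: "'p \<Rightarrow> 'a :: {comm_ring_1, real_algebra_1}"
  assumes pos: "\<And>p. p \<in> P \<Longrightarrow> 0 < w p" and fin: "\<And>k. finite {p \<in> P. w p \<le> k}"
    and power_sums: "\<And>k. (\<Sum>u\<leftarrow>us. u ^ Suc k) = of_nat (Suc k) * (\<Sum>p | p \<in> P \<and> w p = Suc k. a p)"
  shows "complete_sym us d = (\<Sum>\<Lambda>\<in>weighted_msets w P d. exp_term a \<Lambda>)"
proof (rule recurrence_unique)
  have "weighted_msets w P 0 = {{#}}"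
  proof -
    have "\<Lambda> = {#}" if "set_mset \<Lambda> \<subseteq> P" "(\<Sum>p\<in>#\<Lambda>. w p) = 0" for \<Lambda>
      using that by (cases \<Lambda>) (auto dest: pos)
    then show ?thesis by (auto simp: weighted_msets_def)
  qed
  then show "complete_sym us 0 = (\<Sum>\<Lambda>\<in>weighted_msets w P 0. exp_term a \<Lambda>)"
    by (simp add: complete_sym_0 exp_term_def)
qed (fact complete_sym_recurrence, unfold power_sums, rule exp_term_recurrence[OF pos fin])

text \<open>In the multinomial expansion \<open>b\<close> and \<open>c\<close> survive at most once
  each. For \<open>n = 0\<close> the truncated exponent \<open>n - 1\<close> is harmless, as its
  coefficient is 0.\<close>

lemma power_add_two_nilpotents:
  fixes x b c :: "'a :: comm_ring_1"
  assumes "b * b = 0" "c * c = 0"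
  shows "(x + b + c) ^ Suc n = x ^ Suc n + of_nat (Suc n) * x ^ n * (b + c) +
    of_nat (Suc n * n) * x ^ (n - 1) * (b * c)"
proof (induction n)
  case (Suc n)
  have b: "b * (b * y) = 0" and c: "c * (c * y) = 0" for y
    using assms by (simp_all flip: mult.assoc)
  show ?case
    unfolding power_Suc[of _ "Suc n"] Suc
    by (cases n) (simp_all add: algebra_simps assms b c)
qed simp

section \<open>Truncation and order\<close>

fun evar_index :: "evar \<Rightarrow> nat" where
  "evar_index (X i) = i"
| "evar_index (Y i) = i"

fun ovar_index :: "ovar \<Rightarrow> nat" where
  "ovar_index (Phi i) = i"
| "ovar_index (Theta i) = i"
| "ovar_index (TauB i) = i"
| "ovar_index (TauU i) = i"

definition below :: "nat \<Rightarrow> mono \<Rightarrow> bool" where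
  "below N \<mu> \<longleftrightarrow> (\<forall>v\<in>#fst \<mu>. evar_index v < N) \<and> (\<forall>w\<in>snd \<mu>. ovar_index w < N)"

lemma eventually_below:
  assumes "finite (snd \<mu>)"
  shows "\<exists>N0. \<forall>N\<ge>N0. below N \<mu>"
proof -
  let ?I = "evar_index ` set_mset (fst \<mu>) \<union> ovar_index ` snd \<mu>"
  have "i < N" if "Suc (Max ?I) \<le> N" "i \<in> ?I" for i N
  proof -
    have "i \<le> Max ?I" using that(2) by (intro Max_ge) (use assms in auto)
    then show ?thesis using that(1) by simp
  qed
  then show ?thesis unfolding below_def by (intro exI[of _ "Suc (Max ?I)"]) blast
qed

lemma mono_splits_eq:
  assumes "z \<in> mono_splits \<mu>"
  shows "fst \<mu> = fst (fst z) + fst (snd z)" "snd \<mu> = snd (fst z) \<union> snd (snd z)"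
    "snd (fst z) \<inter> snd (snd z) = {}"
  using assms by (auto simp: mono_splits_def)

lemma below_splits: "z \<in> mono_splits \<mu> \<Longrightarrow> below N \<mu> \<longleftrightarrow> below N (fst z) \<and> below N (snd z)"
  by (auto simp: below_def mono_splits_eq)

text \<open>Setting all variables of index at least \<open>N\<close> to 0. It is an algebra
  homomorphism because a product of monomials is below \<open>N\<close> exactly when both factors
  are.\<close>

lift_definition trunc :: "nat \<Rightarrow> gseries \<Rightarrow> gseries" is "\<lambda>N f \<mu>. if below N \<mu> then f \<mu> else 0"
  by auto

lemma trunc_times: "trunc N (f * g) = trunc N f * trunc N g"
proof (rule gseries_eqI)
  fix \<mu> :: mono assume fin: "finite (snd \<mu>)"
  show "coeff (trunc N (f * g)) \<mu> = coeff (trunc N f * trunc N g) \<mu>"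
    unfolding trunc.rep_eq[of N "f * g"] coeff_times[OF fin]
    by (auto simp: trunc.rep_eq below_splits case_prod_unfold intro!: sum.cong sum.neutral)
qed

lemma trunc_1: "trunc N 1 = 1"
  by (rule gseries_eqI) (auto simp: trunc.rep_eq one_gseries.rep_eq sone_def below_def)

lemma trunc_scaleR: "trunc N (c *\<^sub>R f) = c *\<^sub>R trunc N f"
  by (rule gseries_eqI) (simp add: trunc.rep_eq)

lemma trunc_power: "trunc N (f ^ n) = trunc N f ^ n"
  by (induction n) (simp_all add: trunc_1 trunc_times)

lemma trunc_prod_list: "trunc N (\<Prod>p\<leftarrow>ps. f p) = (\<Prod>p\<leftarrow>ps. trunc N (f p))"
  by (induction ps) (simp_all add: trunc_1 trunc_times)

lemma trunc_even_var: "trunc N (even_var v) = (if evar_index v < N then even_var v else 0)"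
  by (rule gseries_eqI) (auto simp: trunc.rep_eq even_var.rep_eq seven_def below_def)

lemma trunc_odd_var: "trunc N (odd_var w) = (if ovar_index w < N then odd_var w else 0)"
  by (rule gseries_eqI) (auto simp: trunc.rep_eq odd_var.rep_eq sodd_def below_def)

lemma coeff_Gseries_ssum: "coeff (Gseries (ssum (\<lambda>i. coeff (t i)))) = ssum (\<lambda>i. coeff (t i))"
  by (rule coeff_Gseries) (simp add: ssum_def coeff_infinite)

text \<open>At a monomial below \<open>N\<close> only indices less than \<open>N\<close> have a
  nonzero coefficient, so the support in \<open>ssum\<close> is finite and the formal sum becomes an
  honest finite one.\<close>

lemma trunc_ssum:
  assumes "\<And>i. trunc N (t i) = (if i < N then t i else 0)"
  shows "trunc N (Gseries (ssum (\<lambda>i. coeff (t i)))) = (\<Sum>i<N. t i)"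
proof (rule gseries_eqI)
  fix \<mu> :: mono
  have t: "(if below N \<mu> then coeff (t i) \<mu> else 0) = (if i < N then coeff (t i) \<mu> else 0)" for i
    using arg_cong[OF assms[of i], of "\<lambda>f. coeff f \<mu>"] by (simp add: trunc.rep_eq split: if_splits)
  show "coeff (trunc N (Gseries (ssum (\<lambda>i. coeff (t i))))) \<mu> = coeff (\<Sum>i<N. t i) \<mu>"
  proof (cases "below N \<mu>")
    case True
    then have "{i. coeff (t i) \<mu> \<noteq> 0} \<subseteq> {..<N}" using t by (auto split: if_splits) (metis)
    then have "ssum (\<lambda>i. coeff (t i)) \<mu> = (\<Sum>i<N. coeff (t i) \<mu>)"
      unfolding ssum_def by (intro sum.mono_neutral_left) auto
    then show ?thesis using True by (simp add: trunc.rep_eq coeff_Gseries_ssum)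
  next
    case False
    then have "coeff (t i) \<mu> = 0" if "i < N" for i using t[of i] that by simp
    then show ?thesis using False by (simp add: trunc.rep_eq)
  qed
qed

section \<open>Order of vanishing and convergence of geometric series\<close>

definition mono_degree :: "mono \<Rightarrow> nat" where
  "mono_degree \<mu> = size (fst \<mu>) + card (snd \<mu>)"

lemma mono_degree_splits:
  assumes "finite (snd \<mu>)" "z \<in> mono_splits \<mu>"
  shows "mono_degree \<mu> = mono_degree (fst z) + mono_degree (snd z)"
  using mono_splits_finite[OF assms]
  by (simp add: mono_degree_def mono_splits_eq[OF assms(2)] card_Un_disjoint)

definition ord_ge :: "nat \<Rightarrow> gseries \<Rightarrow> bool" where
  "ord_ge k f \<longleftrightarrow> (\<forall>\<mu>. mono_degree \<mu> < k \<longrightarrow> coeff f \<mu> = 0)"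

lemma ord_ge_0: "ord_ge 0 f"
  by (simp add: ord_ge_def)

lemma ord_ge_mono: "ord_ge k f \<Longrightarrow> l \<le> k \<Longrightarrow> ord_ge l f"
  by (auto simp: ord_ge_def)

lemma ord_ge_sum: "(\<And>i. i \<in> A \<Longrightarrow> ord_ge k (f i)) \<Longrightarrow> ord_ge k (\<Sum>i\<in>A. f i)"
  by (simp add: ord_ge_def)

lemma ord_ge_add: "ord_ge k f \<Longrightarrow> ord_ge k g \<Longrightarrow> ord_ge k (f + g)"
  by (simp add: ord_ge_def)

lemma ord_ge_scaleR: "ord_ge k f \<Longrightarrow> ord_ge k (c *\<^sub>R f)"
  by (simp add: ord_ge_def)

lemma ord_ge_even_var: "ord_ge 1 (even_var v)"
  by (auto simp: ord_ge_def mono_degree_def even_var.rep_eq seven_def)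

lemma ord_ge_odd_var: "ord_ge 1 (odd_var w)"
  by (auto simp: ord_ge_def mono_degree_def odd_var.rep_eq sodd_def)

lemma ord_ge_times:
  assumes "ord_ge k f" "ord_ge l g"
  shows "ord_ge (k + l) (f * g)"
  unfolding ord_ge_def
proof (intro allI impI)
  fix \<mu> :: mono assume less: "mono_degree \<mu> < k + l"
  show "coeff (f * g) \<mu> = 0"
  proof (cases "finite (snd \<mu>)")
    case fin: True
    have "coeff f (fst z) = 0 \<or> coeff g (snd z) = 0" if "z \<in> mono_splits \<mu>" for z
    proof -
      have "mono_degree (fst z) < k \<or> mono_degree (snd z) < l"
        using less mono_degree_splits[OF fin that] by linarith
      then show ?thesis using assms unfolding ord_ge_def by blast
    qed
    then show ?thesis unfolding coeff_times[OF fin] by (intro sum.neutral) auto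
  qed (simp add: coeff_infinite)
qed

lemma ord_ge_power: "ord_ge k f \<Longrightarrow> ord_ge (n * k) (f ^ n)"
  by (induction n) (simp_all add: ord_ge_0 ord_ge_times)

lemma ord_ge_prod_list:
  "(\<And>p. p \<in> set ps \<Longrightarrow> ord_ge (k p) (f p)) \<Longrightarrow> ord_ge (\<Sum>p\<leftarrow>ps. k p) (\<Prod>p\<leftarrow>ps. f p)"
  by (induction ps) (simp_all add: ord_ge_0 ord_ge_times)

text \<open>The order of \<open>u ^ k\<close> is at least \<open>k\<close>, so powers beyond
  \<open>n\<close> do not reach a monomial of degree at most \<open>n\<close>.\<close>

lemma geom_coeff:
  assumes "ord_ge 1 u" "mono_degree \<mu> \<le> n"
  shows "geom (coeff u) \<mu> = (\<Sum>k\<le>n. coeff (u ^ k) \<mu>)"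
proof -
  have "coeff (u ^ k) \<mu> = 0" if "n < k" for k
    using ord_ge_power[OF assms(1), of k] assms(2) that by (simp add: ord_ge_def del: split_paired_All)
  then have "{k. coeff (u ^ k) \<mu> \<noteq> 0} \<subseteq> {..n}" by (auto simp: not_le[symmetric])
  then show ?thesis
    unfolding geom_def ssum_def coeff_power[symmetric] by (intro sum.mono_neutral_left) auto
qed

lemma coeff_Gseries_geom: "coeff (Gseries (geom (coeff u))) = geom (coeff u)"
  by (rule coeff_Gseries) (simp add: geom_def ssum_def coeff_infinite flip: coeff_power)

lemma ord_ge_complete_sym:
  "(\<And>u. u \<in> set us \<Longrightarrow> ord_ge 1 (of_centre u)) \<Longrightarrow> ord_ge d (of_centre (complete_sym us d))"
proof (induction us arbitrary: d)
  case Nil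
  then show ?case by (simp add: complete_sym_Nil ord_ge_0) (simp add: ord_ge_def)
next
  case (Cons u us)
  have "ord_ge (k + (d - k)) (of_centre u ^ k * of_centre (complete_sym us (d - k)))" for k
    using Cons ord_ge_power[of 1 "of_centre u" k] by (intro ord_ge_times) auto
  then show ?case
    unfolding complete_sym_Cons of_centre_sum of_centre_simps of_centre_power
    by (intro ord_ge_sum) (metis atMost_iff le_add_diff_inverse)
qed

text \<open>This evaluates the generating function of \<open>complete_sym\<close> at
  \<open>t = 1\<close>, which is legitimate coefficientwise. The bound \<open>n\<close> stays fixed
  in the induction, since both components of a splitting have degree at most that of the
  monomial.\<close>

lemma coeff_prod_geom:
  assumes "\<And>u. u \<in> set us \<Longrightarrow> ord_ge 1 (of_centre u)"
    and "mono_degree \<mu> \<le> n"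
  shows "coeff (\<Prod>u\<leftarrow>us. Gseries (geom (coeff (of_centre u)))) \<mu> =
    (\<Sum>d\<le>n. coeff (of_centre (complete_sym us d)) \<mu>)"
  using assms
proof (induction us arbitrary: \<mu>)
  case Nil
  have "(\<Sum>d\<le>n. coeff (of_centre (complete_sym [] d)) \<mu>) = (\<Sum>d\<le>n. if d = 0 then coeff 1 \<mu> else 0)"
    by (rule sum.cong) (simp_all add: complete_sym_Nil)
  then show ?case by simp
next
  case (Cons u us)
  show ?case
  proof (cases "finite (snd \<mu>)")
    case fin: True
    let ?h = "\<lambda>d. of_centre (complete_sym us d)" and ?u = "of_centre u"
    have "coeff (\<Prod>u\<leftarrow>u # us. Gseries (geom (coeff (of_centre u)))) \<mu> =
        coeff ((\<Sum>k\<le>n. ?u ^ k) * (\<Sum>l\<le>n. ?h l)) \<mu>"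
      unfolding list.map prod_list.Cons coeff_times[OF fin]
    proof (rule sum.cong[OF refl])
      fix z assume z: "z \<in> mono_splits \<mu>"
      have "mono_degree (fst z) \<le> n" "mono_degree (snd z) \<le> n"
        using Cons.prems(2) mono_degree_splits[OF fin z] by simp_all
      then show "(case z of (\<alpha>, \<beta>) \<Rightarrow> coeff (Gseries (geom (coeff ?u))) \<alpha> *
          coeff (\<Prod>u\<leftarrow>us. Gseries (geom (coeff (of_centre u)))) \<beta> * osign (snd \<alpha>) (snd \<beta>)) =
        (case z of (\<alpha>, \<beta>) \<Rightarrow> coeff (\<Sum>k\<le>n. ?u ^ k) \<alpha> * coeff (\<Sum>l\<le>n. ?h l) \<beta> * osign (snd \<alpha>) (snd \<beta>))"
        using Cons.IH[of "snd z"] Cons.prems(1)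
        by (simp add: case_prod_unfold coeff_Gseries_geom geom_coeff)
    qed
    also have "\<dots> = (\<Sum>(k, l)\<in>{..n} \<times> {..n}. coeff (?u ^ k * ?h l) \<mu>)"
      by (simp add: sum_product flip: sum.cartesian_product)
    \<comment> \<open>Off the triangle the order \<open>k + l\<close> exceeds the degree of
      \<open>\<mu>\<close>. On it, the diagonal \<open>k + l = d\<close> yields
      \<open>complete_sym (u # us) d\<close>.\<close>
    also have "\<dots> = (\<Sum>(k, l)\<in>{(k, l). k + l \<le> n}. coeff (?u ^ k * ?h l) \<mu>)"
    proof (rule sum.mono_neutral_right)
      have "ord_ge (k + l) (?u ^ k * ?h l)" for k l
        using ord_ge_power[of 1 ?u k] ord_ge_complete_sym[of us l] Cons.prems(1)
        by (intro ord_ge_times) auto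
      then have "coeff (?u ^ k * ?h l) \<mu> = 0" if "\<not> k + l \<le> n" for k l
        using that Cons.prems(2) unfolding ord_ge_def by (meson le_less_trans not_le)
      then show "\<forall>z\<in>{..n} \<times> {..n} - {(k, l). k + l \<le> n}. (case z of (k, l) \<Rightarrow> coeff (?u ^ k * ?h l) \<mu>) = 0"
        by auto
    qed auto
    also have "\<dots> = (\<Sum>d\<le>n. \<Sum>k\<le>d. coeff (?u ^ k * ?h (d - k)) \<mu>)"
      by (rule sum.triangle_reindex_eq)
    also have "\<dots> = (\<Sum>d\<le>n. coeff (of_centre (complete_sym (u # us) d)) \<mu>)"
      by (simp add: complete_sym_Cons of_centre_sum of_centre_power)
    finally show ?thesis .
  qed (simp add: coeff_infinite)
qed

section \<open>Power sums and superpartitions\<close>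

fun mark_degree :: "mark \<Rightarrow> nat" where
  "mark_degree MBi = 2"
| "mark_degree MOv = 1"
| "mark_degree MUn = 1"
| "mark_degree MPlain = 0"

text \<open>The degree of the power sum of \<open>p\<close> in all variables, even and odd; the x
  and y power sums together have twice this degree, matching the degree \<open>2 k\<close> of a
  \<open>k\<close>-th power of a kernel variable.\<close>

definition weight :: "mark \<times> nat \<Rightarrow> nat" where
  "weight p = snd p + mark_degree (fst p)"

abbreviation true_parts :: "(mark \<times> nat) set" where
  "true_parts \<equiv> - {(MPlain, 0)}"

definition summand :: "(nat \<Rightarrow> evar) \<Rightarrow> (nat \<Rightarrow> ovar) \<Rightarrow> (nat \<Rightarrow> ovar) \<Rightarrow> mark \<times> nat \<Rightarrow> nat \<Rightarrow> gseries" where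
  "summand E F G p i = (case fst p of
      MBi \<Rightarrow> odd_var (F i) * odd_var (G i)
    | MOv \<Rightarrow> odd_var (F i)
    | MUn \<Rightarrow> odd_var (G i)
    | MPlain \<Rightarrow> 1) * even_var (E i) ^ snd p"

definition finite_power_sum ::
    "(nat \<Rightarrow> evar) \<Rightarrow> (nat \<Rightarrow> ovar) \<Rightarrow> (nat \<Rightarrow> ovar) \<Rightarrow> nat \<Rightarrow> mark \<times> nat \<Rightarrow> gseries" where
  "finite_power_sum E F G N p = (\<Sum>i<N. summand E F G p i)"

lemma ptilde_eq:
  "ptilde E F G p = (if p = (MPlain, 0) then szero else ssum (\<lambda>i. coeff (summand E F G p i)))"
  by (cases p; cases "fst p")
    (auto simp: ptilde_def summand_def times_gseries.rep_eq odd_var.rep_eq even_var.rep_eq coeff_power)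

lemma coeff_Gseries_ptilde: "coeff (Gseries (ptilde E F G p)) = ptilde E F G p"
  by (rule coeff_Gseries) (simp add: ptilde_eq szero_def ssum_def coeff_infinite)

text \<open>Every summand contains a variable of index \<open>i\<close> and so dies for
  \<open>i \<ge> N\<close>; for marked zeros this is the odd variable. The unmarked zero is
  excluded: its summands are all 1, whereas its power sum is 0 by convention.\<close>

lemma trunc_ptilde:
  assumes "\<And>i. evar_index (E i) = i" "\<And>i. ovar_index (F i) = i" "\<And>i. ovar_index (G i) = i"
    and "p \<noteq> (MPlain, 0)"
  shows "trunc N (Gseries (ptilde E F G p)) = finite_power_sum E F G N p"
proof -
  have "trunc N (summand E F G p i) = (if i < N then summand E F G p i else 0)" for i
    using assms by (cases p; cases "fst p")
      (auto simp: summand_def trunc_times trunc_power trunc_even_var trunc_odd_var trunc_1 zero_power)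
  then show ?thesis
    using trunc_ssum[of N "summand E F G p"] assms(4) by (simp add: ptilde_eq finite_power_sum_def)
qed

lemma parity_finite_power_sum: "parity (mark_degree (fst p)) (finite_power_sum E F G N p)"
proof -
  have "parity (mark_degree m) (case m of MBi \<Rightarrow> odd_var (F i) * odd_var (G i)
      | MOv \<Rightarrow> odd_var (F i) | MUn \<Rightarrow> odd_var (G i) | MPlain \<Rightarrow> 1)" for m i
    using parity_times[OF parity_odd_var[of "F i"] parity_odd_var[of "G i"]]
    by (cases m) (auto simp: parity_one parity_odd_var[unfolded One_nat_def] numeral_2_eq_2)
  then have "parity (mark_degree (fst p) + 0) (summand E F G p i)" for i
    unfolding summand_def by (intro parity_times parity_power parity_even_var)
  then show ?thesis unfolding finite_power_sum_def by (intro parity_sum) simp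
qed

lemma ord_ge_finite_power_sum: "ord_ge (weight p) (finite_power_sum E F G N p)"
proof -
  have "ord_ge (mark_degree m) (case m of MBi \<Rightarrow> odd_var (F i) * odd_var (G i)
      | MOv \<Rightarrow> odd_var (F i) | MUn \<Rightarrow> odd_var (G i) | MPlain \<Rightarrow> 1)" for m i
    using ord_ge_times[OF ord_ge_odd_var[of "F i"] ord_ge_odd_var[of "G i"]]
    by (cases m) (auto simp: ord_ge_0 ord_ge_odd_var[unfolded One_nat_def] numeral_2_eq_2)
  then have "ord_ge (mark_degree (fst p) + snd p * 1) (summand E F G p i)" for i
    unfolding summand_def by (intro ord_ge_times ord_ge_power ord_ge_even_var)
  then show ?thesis
    unfolding finite_power_sum_def weight_def by (intro ord_ge_sum) (simp add: add.commute)
qed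

abbreviation x_power_sum :: "nat \<Rightarrow> mark \<times> nat \<Rightarrow> gseries" where
  "x_power_sum \<equiv> finite_power_sum X Phi Theta"

abbreviation y_power_sum :: "nat \<Rightarrow> mark \<times> nat \<Rightarrow> gseries" where
  "y_power_sum \<equiv> finite_power_sum Y TauB TauU"

text \<open>The sign is the one that \<open>prod_list_interleave\<close> leaves at each factor.\<close>

definition pair_term :: "nat \<Rightarrow> mark \<times> nat \<Rightarrow> gseries" where
  "pair_term N p = (-1) ^ (mark_degree (fst p) choose 2) *\<^sub>R (x_power_sum N p * y_power_sum N p)"

text \<open>The reciprocals of the factors \<open>k\<close> in \<open>zee\<close> and
  \<open>1 / (k + 1)\<close> in \<open>zeta\<close> per part; they come from the coefficients of
  \<open>kernel_var i j ^ Suc k\<close> divided by \<open>Suc k\<close>.\<close>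

fun part_coeff :: "mark \<times> nat \<Rightarrow> real" where
  "part_coeff (MPlain, n) = 1 / real n"
| "part_coeff (MBi, n) = real (n + 1)"
| "part_coeff (MOv, n) = 1"
| "part_coeff (MUn, n) = 1"

text \<open>The summands of the logarithm of the finite kernel. \<open>Centre\<close> is applied to
  a central element, as both power sums of \<open>p\<close> have the same parity and their product
  is even.\<close>

definition log_term :: "nat \<Rightarrow> mark \<times> nat \<Rightarrow> gseries centre" where
  "log_term N p = part_coeff p *\<^sub>R Centre (pair_term N p)"

lemma parity_even_degree: "parity (e + e) f \<Longrightarrow> parity 0 f"
  by (simp add: parity_def)

lemma of_centre_even: "parity 0 f \<Longrightarrow> of_centre (Centre f) = f"
  by (rule of_centre_Centre) (rule even_commute)

lemma of_centre_log_term: "of_centre (log_term N p) = part_coeff p *\<^sub>R pair_term N p"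
proof -
  have "parity 0 (x_power_sum N p * y_power_sum N p)"
    by (rule parity_even_degree[OF parity_times[OF parity_finite_power_sum parity_finite_power_sum]])
  then have "parity 0 (pair_term N p)" by (simp add: pair_term_def parity_def)
  then show ?thesis by (simp add: log_term_def of_centre_even)
qed

text \<open>For odd \<open>A\<close> and \<open>B\<close>,
  \<open>A B A B = - A A B B = 0\<close>.\<close>

lemma log_term_square:
  assumes "mark_degree (fst p) = 1"
  shows "log_term N p * log_term N p = 0"
proof -
  let ?A = "x_power_sum N p" and ?B = "y_power_sum N p"
  have odd: "parity 1 ?A" "parity 1 ?B" using parity_finite_power_sum assms by metis+
  have "?A * ?B * (?A * ?B) = ?A * (?B * ?A) * ?B" by (simp only: mult.assoc)
  also have "\<dots> = - (?A * ?A * (?B * ?B))" using supercommute[OF odd] by (simp add: mult.assoc)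
  finally have "?A * ?B * (?A * ?B) = 0" using odd_square[OF odd(1)] by simp
  then show ?thesis
    by (simp add: of_centre_log_term pair_term_def flip: of_centre_inject)
qed

text \<open>The exponential runs over all multisets of parts; a repeated overlined or underlined
  part contributes a vanishing square, which leaves exactly the superpartitions.\<close>

lemma exp_term_not_sp:
  assumes "set_mset \<Lambda> \<subseteq> true_parts" "\<not> is_sp \<Lambda>"
  shows "exp_term (log_term N) \<Lambda> = 0"
proof -
  have "count \<Lambda> (MPlain, 0) = 0" using assms(1) by (auto simp: not_in_iff[symmetric])
  then obtain a where "2 \<le> count \<Lambda> (MOv, a) \<or> 2 \<le> count \<Lambda> (MUn, a)"
    using assms(2) unfolding is_sp_def by (metis not_less_eq_eq one_add_one plus_1_eq_Suc)
  then obtain p where p: "mark_degree (fst p) = 1" "2 \<le> count \<Lambda> p"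
    by (metis fst_conv mark_degree.simps(2,3))
  then have "replicate_mset 2 p \<subseteq># \<Lambda>" by (simp add: count_le_replicate_mset_subset_eq)
  then obtain \<Lambda>' where "\<Lambda> = replicate_mset 2 p + \<Lambda>'" by (metis subset_mset.add_diff_inverse)
  then show ?thesis
    using log_term_square[OF p(1), of N] by (simp add: exp_term_def numeral_2_eq_2 flip: mult.assoc)
qed

section \<open>Matching signs and constants with the terms of the Cauchy sum\<close>

lemma mset_parts: "mset (parts \<Lambda>) = \<Lambda>"
proof -
  obtain xs where xs: "mset xs = \<Lambda>" by (metis ex_mset)
  have "sorted_wrt (\<lambda>p q. part_key p \<le> part_key q) (sort_key part_key xs)"
    by (metis sorted_map sorted_sort_key)
  then have "mset (rev (sort_key part_key xs)) = \<Lambda> \<and>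
      sorted_wrt (\<lambda>p q. part_key q \<le> part_key p) (rev (sort_key part_key xs))"
    by (simp add: xs sorted_wrt_rev)
  then show ?thesis unfolding parts_def by (rule someI2) simp
qed

lemma sum_mark_degree: "(\<Sum>p\<leftarrow>parts \<Lambda>. mark_degree (fst p)) = mbar \<Lambda> + munder \<Lambda>"
proof -
  have "(\<Sum>p\<in>#\<Lambda>. mark_degree (fst p)) = mbar \<Lambda> + munder \<Lambda>"
  proof (induction \<Lambda>)
    case (add p \<Lambda>)
    then show ?case by (cases "fst p") (simp_all add: mbar_def munder_def)
  qed (simp add: mbar_def munder_def)
  then show ?thesis by (metis mset_map mset_parts sum_mset_sum_list)
qed

text \<open>The product over distinct parts of \<open>n! / c ^ n\<close>, with \<open>n\<close> the
  multiplicity and \<open>c\<close> the coefficient, is split by marking: unmarked parts give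
  \<open>zee\<close>, bilined ones \<open>zeta\<close>, and the others 1 because their multiplicity
  is at most 1.\<close>

lemma prod_part_coeff:
  assumes "is_sp \<Lambda>"
  shows "(\<Prod>p\<in>#\<Lambda>. part_coeff p) / (\<Prod>p\<in>set_mset \<Lambda>. fact (count \<Lambda> p)) = 1 / (zee \<Lambda> * zeta \<Lambda>)"
proof -
  define g where "g p = fact (count \<Lambda> p) / part_coeff p ^ count \<Lambda> p" for p
  let ?S = "\<lambda>m. {p \<in> set_mset \<Lambda>. fst p = m}"
  have fact: "fact n = (1 :: real)" if "n \<le> 1" for n
    using that by (cases n) simp_all
  have S: "set_mset \<Lambda> = ?S MPlain \<union> (?S MBi \<union> (?S MOv \<union> ?S MUn))"
    using mark.exhaust by blast
  have "(\<Prod>p\<in>set_mset \<Lambda>. g p) = prod g (?S MPlain) * (prod g (?S MBi) * (prod g (?S MOv) * prod g (?S MUn)))"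
    by (subst S, subst prod.union_disjoint, simp, simp, force)+ simp
  also have "prod g (?S MPlain) = zee \<Lambda>"
    unfolding zee_def
    by (rule prod.reindex_bij_witness[where i = "\<lambda>k. (MPlain, k)" and j = snd])
      (use assms in \<open>auto simp: g_def is_sp_def power_divide not_in_iff[symmetric] Suc_le_eq intro!: gr0I\<close>)
  also have "prod g (?S MBi) = zeta \<Lambda>"
    unfolding zeta_def
    by (rule prod.reindex_bij_witness[where i = "\<lambda>k. (MBi, k)" and j = snd]) (auto simp: g_def)
  also have "prod g (?S MOv) = 1"
    using assms by (intro prod.neutral) (auto simp: g_def is_sp_def fact)
  also have "prod g (?S MUn) = 1"
    using assms by (intro prod.neutral) (auto simp: g_def is_sp_def fact)
  finally have g: "zee \<Lambda> * zeta \<Lambda> = (\<Prod>p\<in>set_mset \<Lambda>. g p)" by simp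
  show ?thesis
    unfolding image_prod_mset_multiplicity g by (simp add: g_def prod_dividef)
qed

lemma of_centre_exp_log_term:
  "of_centre (exp_term (log_term N) \<Lambda>) =
    ((\<Prod>p\<in>#\<Lambda>. part_coeff p) / (\<Prod>p\<in>set_mset \<Lambda>. fact (count \<Lambda> p))) *\<^sub>R (\<Prod>p\<leftarrow>parts \<Lambda>. pair_term N p)"
proof -
  have list: "(\<Prod>p\<in>#\<Lambda>. f p) = (\<Prod>p\<leftarrow>parts \<Lambda>. f p)" for f :: "_ \<Rightarrow> 'a :: comm_monoid_mult"
    by (metis mset_map mset_parts prod_mset_prod_list)
  have "(\<Prod>p\<leftarrow>ps. part_coeff p *\<^sub>R pair_term N p) = (\<Prod>p\<leftarrow>ps. part_coeff p) *\<^sub>R (\<Prod>p\<leftarrow>ps. pair_term N p)" for ps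
    by (induction ps) simp_all
  then show ?thesis
    unfolding exp_term_def of_centre_simps list of_centre_prod_list of_centre_log_term by simp
qed

text \<open>Truncation does not change the coefficient at a monomial below \<open>N\<close>, but
  turns all power sums into finite ones. Interleaving the two products produces the sign already
  present in \<open>cauchy_term\<close>, and the two signs cancel.\<close>

lemma cauchy_term_eq:
  assumes "is_sp \<Lambda>" "below N \<mu>"
  shows "cauchy_term \<Lambda> \<mu> = coeff (of_centre (exp_term (log_term N) \<Lambda>)) \<mu>"
proof -
  let ?A = "\<lambda>p. Gseries (ptilde X Phi Theta p)" and ?B = "\<lambda>p. Gseries (ptilde Y TauB TauU p)"
  let ?m = "mbar \<Lambda> + munder \<Lambda>"
  define C where "C = ((-1) ^ (?m choose 2) / (zee \<Lambda> * zeta \<Lambda>)) *\<^sub>R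
    ((\<Prod>p\<leftarrow>parts \<Lambda>. ?A p) * (\<Prod>p\<leftarrow>parts \<Lambda>. ?B p))"
  have "cauchy_term \<Lambda> \<mu> = coeff C \<mu>"
    by (simp add: cauchy_term_def sscale_def pLam_def C_def times_gseries.rep_eq coeff_prod_list
        coeff_Gseries_ptilde comp_def)
  also have "\<dots> = coeff (trunc N C) \<mu>" using assms(2) by (simp add: trunc.rep_eq)
  also have "trunc N C = ((-1) ^ (?m choose 2) / (zee \<Lambda> * zeta \<Lambda>)) *\<^sub>R
    ((\<Prod>p\<leftarrow>parts \<Lambda>. x_power_sum N p) * (\<Prod>p\<leftarrow>parts \<Lambda>. y_power_sum N p))"
  proof -
    have "p \<noteq> (MPlain, 0)" if "p \<in> set (parts \<Lambda>)" for p
      using that assms(1) by (metis is_sp_def not_in_iff mset_parts set_mset_mset)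
    then have maps: "map (\<lambda>p. trunc N (?A p)) (parts \<Lambda>) = map (x_power_sum N) (parts \<Lambda>)"
      "map (\<lambda>p. trunc N (?B p)) (parts \<Lambda>) = map (y_power_sum N) (parts \<Lambda>)"
      by (simp_all add: trunc_ptilde)
    show ?thesis by (simp only: C_def trunc_scaleR trunc_times trunc_prod_list maps)
  qed
  also have "(\<Prod>p\<leftarrow>parts \<Lambda>. x_power_sum N p) * (\<Prod>p\<leftarrow>parts \<Lambda>. y_power_sum N p) =
      (-1) ^ (?m choose 2) *\<^sub>R (\<Prod>p\<leftarrow>parts \<Lambda>. pair_term N p)"
    unfolding pair_term_def sum_mark_degree[symmetric]
    by (rule prod_list_interleave) (rule parity_finite_power_sum)+
  finally show ?thesis
    unfolding of_centre_exp_log_term prod_part_coeff[OF assms(1)]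
    by (simp flip: power_add mult_2)
qed

lemma ord_ge_exp_log_term: "ord_ge (\<Sum>p\<in>#\<Lambda>. weight p) (of_centre (exp_term (log_term N) \<Lambda>))"
proof -
  have "ord_ge (weight p + weight p) (pair_term N p)" for p
    unfolding pair_term_def by (intro ord_ge_scaleR ord_ge_times ord_ge_finite_power_sum)
  then have "ord_ge (weight p) (pair_term N p)" for p
    using ord_ge_mono by (meson le_add1)
  then have "ord_ge (\<Sum>p\<leftarrow>parts \<Lambda>. weight p) (\<Prod>p\<leftarrow>parts \<Lambda>. pair_term N p)"
    by (intro ord_ge_prod_list)
  moreover have "(\<Sum>p\<leftarrow>parts \<Lambda>. weight p) = (\<Sum>p\<in>#\<Lambda>. weight p)"
    by (metis mset_map mset_parts sum_mset_sum_list)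
  ultimately show ?thesis unfolding of_centre_exp_log_term by (simp add: ord_ge_scaleR)
qed

section \<open>The kernel\<close>

definition kernel_var :: "nat \<Rightarrow> nat \<Rightarrow> gseries centre" where
  "kernel_var i j = Centre (even_var (X i) * even_var (Y j)) +
    Centre (odd_var (Phi i) * odd_var (TauB j)) + Centre (odd_var (Theta i) * odd_var (TauU j))"

lemma parity_pairs: "parity 0 (even_var v * even_var v')" "parity 0 (odd_var w * odd_var w')"
  using parity_times[OF parity_even_var parity_even_var] parity_even_degree[of 1]
    parity_times[OF parity_odd_var parity_odd_var] by auto

lemma coeff_kernel_var: "coeff (of_centre (kernel_var i j)) = uvar i j"
  unfolding kernel_var_def uvar_def of_centre_simps
  by (auto simp: of_centre_even parity_pairs sadd_def times_gseries.rep_eq odd_var.rep_eq even_var.rep_eq)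

lemma ord_ge_kernel_var: "ord_ge 1 (of_centre (kernel_var i j))"
proof -
  have "ord_ge (1 + 1) (of_centre (kernel_var i j))"
    unfolding kernel_var_def of_centre_simps of_centre_even[OF parity_pairs(1)] of_centre_even[OF parity_pairs(2)]
    by (intro ord_ge_add ord_ge_times ord_ge_even_var ord_ge_odd_var)
  then show ?thesis using ord_ge_mono by force
qed

lemma odd_pair_square: "odd_var w * odd_var w' * (odd_var w * odd_var w') = 0"
proof -
  have "odd_var w * odd_var w' * (odd_var w * odd_var w') = odd_var w * (odd_var w' * odd_var w) * odd_var w'"
    by (simp only: mult.assoc)
  also have "\<dots> = - (odd_var w * odd_var w * (odd_var w' * odd_var w'))"
    using supercommute[OF parity_odd_var parity_odd_var, of w' w] by (simp add: mult.assoc)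
  finally show ?thesis using odd_square[OF parity_odd_var] by simp
qed

lemma of_centre_of_nat: "of_centre (of_nat n) = of_nat n"
  by (induction n) simp_all

lemma kernel_var_power:
  fixes i j k :: nat
  defines "x \<equiv> even_var (X i) * even_var (Y j)"
  shows "of_centre (kernel_var i j) ^ Suc k = x ^ Suc k
    + real (Suc k) *\<^sub>R (x ^ k * (odd_var (Phi i) * odd_var (TauB j)))
    + real (Suc k) *\<^sub>R (x ^ k * (odd_var (Theta i) * odd_var (TauU j)))
    + real (Suc k * k) *\<^sub>R (x ^ (k - 1) *
        (odd_var (Phi i) * odd_var (TauB j) * (odd_var (Theta i) * odd_var (TauU j))))"
proof -
  let ?b = "odd_var (Phi i) * odd_var (TauB j)" and ?c = "odd_var (Theta i) * odd_var (TauU j)"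
  have [simp]: "of_centre (Centre x) = x" "of_centre (Centre ?b) = ?b" "of_centre (Centre ?c) = ?c"
    by (simp_all add: of_centre_even parity_pairs x_def)
  have "Centre ?b * Centre ?b = 0" "Centre ?c * Centre ?c = 0"
    by (simp_all add: odd_pair_square flip: of_centre_inject)
  then have "of_centre (kernel_var i j ^ Suc k) = of_centre (Centre x ^ Suc k +
      of_nat (Suc k) * Centre x ^ k * (Centre ?b + Centre ?c) +
      of_nat (Suc k * k) * Centre x ^ (k - 1) * (Centre ?b * Centre ?c))"
    unfolding kernel_var_def x_def[symmetric] by (simp only: power_add_two_nilpotents)
  also have "\<dots> = x ^ Suc k + of_nat (Suc k) * x ^ k * (?b + ?c) + of_nat (Suc k * k) * x ^ (k - 1) * (?b * ?c)"
    by (simp only: of_centre_simps of_centre_power of_centre_of_nat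
        \<open>of_centre (Centre x) = x\<close> \<open>of_centre (Centre ?b) = ?b\<close> \<open>of_centre (Centre ?c) = ?c\<close>)
  finally show ?thesis
    by (simp only: of_centre_power mult.assoc mult_scaleR_left of_nat_mult_scaleR distrib_left scaleR_add_right add.assoc)
qed

lemma even_var_commute: "even_var v ^ k * f = f * even_var v ^ k"
  by (intro even_commute parity_power parity_even_var)

lemma even_pair_power: "(even_var v * even_var v') ^ k = even_var v ^ k * even_var v' ^ k"
proof (induction k)
  case (Suc k)
  then show ?case
    using even_var_commute[of v k "even_var v'"] by (simp add: mult.assoc) (simp flip: mult.assoc)
qed simp

text \<open>Even variables are central, so their powers move to the front and leave the odd factors,
  which are the summands of the zero part with the same mark.\<close>

lemma product_x_y_power_sum:
  "x_power_sum N (m, k) * y_power_sum N (m, k) = (\<Sum>i<N. \<Sum>j<N.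
    (even_var (X i) * even_var (Y j)) ^ k * (summand X Phi Theta (m, 0) i * summand Y TauB TauU (m, 0) j))"
proof -
  have "summand X Phi Theta (m, k) i * summand Y TauB TauU (m, k) j =
      (even_var (X i) * even_var (Y j)) ^ k * (summand X Phi Theta (m, 0) i * summand Y TauB TauU (m, 0) j)" for i j
  proof -
    let ?f = "summand X Phi Theta (m, 0) i" and ?g = "summand Y TauB TauU (m, 0) j"
    let ?x = "even_var (X i) ^ k" and ?y = "even_var (Y j) ^ k"
    have "summand X Phi Theta (m, k) i = ?f * ?x" "summand Y TauB TauU (m, k) j = ?g * ?y"
      by (simp_all add: summand_def)
    moreover have "?f * ?x * (?g * ?y) = ?x * ?y * (?f * ?g)"
      by (metis even_var_commute mult.assoc)
    ultimately show ?thesis by (simp add: even_pair_power)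
  qed
  then show ?thesis unfolding finite_power_sum_def sum_product by simp
qed

text \<open>Exchanging the middle two of the four odd variables costs a sign, which the sign
  \<open>(-1) ^ (2 choose 2)\<close> in \<open>pair_term\<close> cancels.\<close>

lemma pair_term_bilined:
  "pair_term N (MBi, k) = (\<Sum>i<N. \<Sum>j<N. (even_var (X i) * even_var (Y j)) ^ k *
    (odd_var (Phi i) * odd_var (TauB j) * (odd_var (Theta i) * odd_var (TauU j))))"
proof -
  have "odd_var (Phi i) * odd_var (Theta i) * (odd_var (TauB j) * odd_var (TauU j)) =
      - (odd_var (Phi i) * odd_var (TauB j) * (odd_var (Theta i) * odd_var (TauU j)))" for i j
  proof -
    have "odd_var (Theta i) * odd_var (TauB j) = - (odd_var (TauB j) * odd_var (Theta i))"
      using supercommute[OF parity_odd_var parity_odd_var, of "TauB j" "Theta i"] by simp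
    then show ?thesis by (metis mult.assoc mult_minus_left mult_minus_right)
  qed
  then show ?thesis
    unfolding pair_term_def product_x_y_power_sum by (simp add: summand_def sum_negf)
qed

lemma weight_level:
  "{p \<in> true_parts. weight p = Suc k} =
    {(MPlain, Suc k), (MOv, k), (MUn, k)} \<union> (if k = 0 then {} else {(MBi, k - 1)})"
proof -
  have "p \<in> true_parts \<and> weight p = Suc k \<longleftrightarrow>
    p = (MPlain, Suc k) \<or> p = (MOv, k) \<or> p = (MUn, k) \<or> k \<noteq> 0 \<and> p = (MBi, k - 1)" for p
    by (cases p; cases "fst p") (auto simp: weight_def)
  then show ?thesis by auto
qed

lemma weight_pos: "p \<in> true_parts \<Longrightarrow> 0 < weight p"
  by (cases p; cases "fst p") (auto simp: weight_def)

lemma finite_weight: "finite {p \<in> true_parts. weight p \<le> k}"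
proof -
  have "fst p \<in> {MBi, MOv, MUn, MPlain}" for p :: "mark \<times> nat"
    by (cases "fst p") simp_all
  then have "{p \<in> true_parts. weight p \<le> k} \<subseteq> {MBi, MOv, MUn, MPlain} \<times> {..k}"
    by (force simp: weight_def mem_Times_iff)
  then show ?thesis by (rule finite_subset) simp
qed

text \<open>The four terms of a power of a kernel variable, summed over \<open>i\<close> and
  \<open>j\<close>, are the pair terms of the at most four parts of weight \<open>Suc k\<close>, one
  per mark.\<close>

lemma power_sum_kernel_var:
  "(\<Sum>u\<leftarrow>map (\<lambda>(i, j). kernel_var i j) (List.product [0..<N] [0..<N]). u ^ Suc k) =
    of_nat (Suc k) * (\<Sum>p | p \<in> true_parts \<and> weight p = Suc k. log_term N p)"
proof -
  let ?x = "\<lambda>i j. even_var (X i) * even_var (Y j)"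
  let ?b = "\<lambda>i j. odd_var (Phi i) * odd_var (TauB j)" and ?c = "\<lambda>i j. odd_var (Theta i) * odd_var (TauU j)"
  let ?S = "\<lambda>f. \<Sum>i<N. \<Sum>j<N. f i j :: gseries"
  have "(\<Sum>u\<leftarrow>map (\<lambda>(i, j). kernel_var i j) (List.product [0..<N] [0..<N]). u ^ Suc k) =
      (\<Sum>z\<in>set (List.product [0..<N] [0..<N]). (case z of (i, j) \<Rightarrow> kernel_var i j) ^ Suc k)"
    by (subst sum_list_distinct_conv_sum_set[symmetric]) (simp_all add: distinct_product comp_def)
  also have "\<dots> = (\<Sum>i<N. \<Sum>j<N. kernel_var i j ^ Suc k)"
    by (simp add: sum.cartesian_product case_prod_unfold atLeast0LessThan del: power_Suc)
  finally have "of_centre (\<Sum>u\<leftarrow>map (\<lambda>(i, j). kernel_var i j) (List.product [0..<N] [0..<N]). u ^ Suc k) =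
      ?S (\<lambda>i j. of_centre (kernel_var i j) ^ Suc k)"
    by (simp only: of_centre_sum of_centre_power)
  also have "\<dots> = ?S (\<lambda>i j. ?x i j ^ Suc k) + real (Suc k) *\<^sub>R ?S (\<lambda>i j. ?x i j ^ k * ?b i j) +
      real (Suc k) *\<^sub>R ?S (\<lambda>i j. ?x i j ^ k * ?c i j) +
      real (Suc k * k) *\<^sub>R ?S (\<lambda>i j. ?x i j ^ (k - 1) * (?b i j * ?c i j))"
    by (simp only: kernel_var_power sum.distrib scaleR_sum_right)
  also have "?S (\<lambda>i j. ?x i j ^ Suc k) = pair_term N (MPlain, Suc k)"
    unfolding pair_term_def product_x_y_power_sum by (simp add: summand_def numeral_2_eq_2)
  also have "?S (\<lambda>i j. ?x i j ^ k * ?b i j) = pair_term N (MOv, k)"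
    unfolding pair_term_def product_x_y_power_sum by (simp add: summand_def numeral_2_eq_2)
  also have "?S (\<lambda>i j. ?x i j ^ k * ?c i j) = pair_term N (MUn, k)"
    unfolding pair_term_def product_x_y_power_sum by (simp add: summand_def numeral_2_eq_2)
  also have "?S (\<lambda>i j. ?x i j ^ (k - 1) * (?b i j * ?c i j)) = pair_term N (MBi, k - 1)"
    unfolding pair_term_bilined ..
  \<comment> \<open>After division by \<open>Suc k\<close> the bilined part of value
    \<open>k - 1\<close> has coefficient \<open>k\<close>, its value plus one. For
    \<open>k = 0\<close> no such part has weight \<open>Suc k\<close>, and the left-hand coefficient
    is 0.\<close>
  also have "pair_term N (MPlain, Suc k) + real (Suc k) *\<^sub>R pair_term N (MOv, k) +
      real (Suc k) *\<^sub>R pair_term N (MUn, k) + real (Suc k * k) *\<^sub>R pair_term N (MBi, k - 1) =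
      real (Suc k) *\<^sub>R (\<Sum>p | p \<in> true_parts \<and> weight p = Suc k. part_coeff p *\<^sub>R pair_term N p)"
  proof -
    have "real (Suc k) *\<^sub>R part_coeff (MPlain, Suc k) *\<^sub>R pair_term N (MPlain, Suc k) = pair_term N (MPlain, Suc k)"
      by simp
    moreover have "real (Suc k * k) *\<^sub>R pair_term N (MBi, k - 1) =
        real (Suc k) *\<^sub>R part_coeff (MBi, k - 1) *\<^sub>R pair_term N (MBi, k - 1)" if "k \<noteq> 0"
      using that by (simp add: distrib_right)
    ultimately show ?thesis
      unfolding weight_level by (cases "k = 0") (simp_all add: scaleR_add_right del: of_nat_Suc of_nat_mult part_coeff.simps(1,2))
  qed
  also have "\<dots> = of_centre (of_nat (Suc k) * (\<Sum>p | p \<in> true_parts \<and> weight p = Suc k. log_term N p))"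
    by (simp only: of_nat_mult_scaleR of_centre_simps of_centre_sum of_centre_log_term)
  finally show ?thesis by (simp only: of_centre_inject)
qed

lemma Kfin_coeff:
  assumes "mono_degree \<mu> \<le> n"
  shows "Kfin N \<mu> = (\<Sum>d\<le>n. \<Sum>\<Lambda>\<in>weighted_msets weight true_parts d. coeff (of_centre (exp_term (log_term N) \<Lambda>)) \<mu>)"
proof -
  let ?us = "map (\<lambda>(i, j). kernel_var i j) (List.product [0..<N] [0..<N])"
  have "Kfin N = coeff (\<Prod>u\<leftarrow>?us. Gseries (geom (coeff (of_centre u))))"
    by (simp add: Kfin_def coeff_prod_list coeff_Gseries_geom comp_def case_prod_unfold)
      (simp add: coeff_kernel_var)
  then have "Kfin N \<mu> = (\<Sum>d\<le>n. coeff (of_centre (complete_sym ?us d)) \<mu>)"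
    by (simp only:) (rule coeff_prod_geom[OF _ assms], use ord_ge_kernel_var in auto)
  moreover have "complete_sym ?us d = (\<Sum>\<Lambda>\<in>weighted_msets weight true_parts d. exp_term (log_term N) \<Lambda>)" for d
    by (rule complete_sym_eq_exp[OF weight_pos finite_weight power_sum_kernel_var])
  ultimately show ?thesis by (simp add: of_centre_sum)
qed

text \<open>Equality with the infinite product is stated coefficientwise: each coefficient of the
  partial products is eventually constant. The finiteness clause ensures that the sum over
  superpartitions is a genuine one and not a default 0.\<close>

theorem mainTheorem6:
  fixes \<mu> :: mono
  assumes "finite (snd \<mu>)"
  shows "finite {\<Lambda>. is_sp \<Lambda> \<and> cauchy_term \<Lambda> \<mu> \<noteq> 0}
    \<and> (\<exists>N0. \<forall>N\<ge>N0. Kfin N \<mu> = (\<Sum>\<Lambda> | is_sp \<Lambda> \<and> cauchy_term \<Lambda> \<mu> \<noteq> 0. cauchy_term \<Lambda> \<mu>))"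
proof -
  let ?n = "mono_degree \<mu>" and ?T = "{\<Lambda>. is_sp \<Lambda> \<and> cauchy_term \<Lambda> \<mu> \<noteq> 0}"
  let ?W = "weighted_msets weight true_parts"
  obtain N0 where N0: "below N \<mu>" if "N0 \<le> N" for N using eventually_below[OF assms] by blast
  have finW: "finite (?W d)" for d using finite_weighted_msets[OF weight_pos finite_weight] .
  \<comment> \<open>\<open>cauchy_term\<close> does not depend on \<open>N\<close>, so the single
    level \<open>N0\<close> suffices: a nonzero coefficient forces the weight to be at most the
    degree of \<open>\<mu>\<close>.\<close>
  have T: "?T \<subseteq> (\<Union>d\<le>?n. ?W d)"
  proof
    fix \<Lambda> assume \<Lambda>: "\<Lambda> \<in> ?T"
    then have "coeff (of_centre (exp_term (log_term N0) \<Lambda>)) \<mu> \<noteq> 0"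
      using cauchy_term_eq[of \<Lambda> N0 \<mu>] N0[of N0] by simp
    then have "(\<Sum>p\<in>#\<Lambda>. weight p) \<le> ?n"
      using ord_ge_exp_log_term[of \<Lambda> N0] unfolding ord_ge_def by (meson not_le)
    moreover have "set_mset \<Lambda> \<subseteq> true_parts" using \<Lambda> by (auto simp: is_sp_def not_in_iff[symmetric])
    ultimately show "\<Lambda> \<in> (\<Union>d\<le>?n. ?W d)" by (auto simp: weighted_msets_def)
  qed
  have fin: "finite (\<Union>d\<le>?n. ?W d)" using finW by blast
  have "Kfin N \<mu> = (\<Sum>\<Lambda>\<in>?T. cauchy_term \<Lambda> \<mu>)" if "N0 \<le> N" for N
  proof -
    let ?e = "\<lambda>\<Lambda>. coeff (of_centre (exp_term (log_term N) \<Lambda>)) \<mu>"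
    have sp: "cauchy_term \<Lambda> \<mu> = ?e \<Lambda>" if "is_sp \<Lambda>" for \<Lambda>
      using cauchy_term_eq[OF that N0[OF \<open>N0 \<le> N\<close>]] .
    have "Kfin N \<mu> = (\<Sum>d\<le>?n. \<Sum>\<Lambda>\<in>?W d. ?e \<Lambda>)" by (rule Kfin_coeff) simp
    also have "\<dots> = (\<Sum>\<Lambda>\<in>(\<Union>d\<le>?n. ?W d). ?e \<Lambda>)"
      by (rule sum.UNION_disjoint[symmetric]) (use finW in \<open>auto simp: weighted_msets_def\<close>)
    also have "\<dots> = (\<Sum>\<Lambda>\<in>?T. ?e \<Lambda>)"
    \<comment> \<open>A discarded multiset either is no superpartition, so that its term vanishes,
      or is one whose coefficient at \<open>\<mu>\<close> is 0.\<close>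
    proof (rule sum.mono_neutral_right[OF fin T], intro ballI)
      fix \<Lambda> assume \<Lambda>: "\<Lambda> \<in> (\<Union>d\<le>?n. ?W d) - ?T"
      then show "?e \<Lambda> = 0"
        using sp exp_term_not_sp[of \<Lambda> N] by (cases "is_sp \<Lambda>") (auto simp: weighted_msets_def)
    qed
    also have "\<dots> = (\<Sum>\<Lambda>\<in>?T. cauchy_term \<Lambda> \<mu>)" by (rule sum.cong) (simp_all add: sp)
    finally show ?thesis .
  qed
  then show ?thesis using finite_subset[OF T fin] by blast
qed

end
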